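(* Let $n\ge 3$. (i) Let $K\subset\mathbb{R}^n$ be a convex body. Assume that for every two-dimensional linear subspace $P\subset\mathbb{R}^n$ the planar convex body $K|P$ has $q$-fold rotational symmetry (up to translation) for some integer $q=q(P)\ge 4$ (which may depend on $P$), i.e. there exist a rotation $\varphi_q\in SO(P,2)$ of $P$ by the angle $\frac{2\pi}{q}$ and a vector $b_P\in P$ such that $$\varphi_q(K|P)+b_P=K|P.$$ Then $K$ is a Euclidean ball. (ii) On the other hand, there exist strictly convex bodies $K\subset\mathbb{R}^n$ of constant width that are not centrally symmetric and such that for every two-dimensional linear subspace $P\subset\mathbb{R}^n$ the projection $K|P$ has $3$-fold rotational symmetry up to translation, i.e. there exist a rotation $\varphi_3$ of $P$ by the angle $\frac{2\pi}{3}$ and a vector $b_P\in P$ with $\varphi_3(K|P)+b_P=K|P$.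
   Context: A convex body in $\mathbb{R}^n$ is a compact convex set with nonempty interior. For a linear subspace $P\subset\mathbb{R}^n$, $K|P$ denotes the orthogonal projection of $K$ onto $P$. For a two-dimensional subspace $P$, $SO(P,2)$ is the group of rotations (orientation-preserving linear isometries) of $P$. A Euclidean ball may have any center and any positive radius. Centrally symmetric means symmetric with respect to some point. *)

theory Defs
  imports "HOL-Analysis.Analysis"
begin

definition convex_body :: "'a::euclidean_space set \<Rightarrow> bool" where
  "convex_body K \<longleftrightarrow> compact K \<and> convex K \<and> interior K \<noteq> {}"

definition strictly_convex_body :: "'a::euclidean_space set \<Rightarrow> bool" where
  "strictly_convex_body K \<longleftrightarrow>
     convex_body K \<and> (\<forall>x\<in>K. \<forall>y\<in>K. x \<noteq> y \<longrightarrow> open_segment x y \<subseteq> interior K)"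

definition support_function :: "'a::euclidean_space set \<Rightarrow> 'a \<Rightarrow> real" where
  "support_function K u = (SUP x\<in>K. x \<bullet> u)"

definition constant_width :: "'a::euclidean_space set \<Rightarrow> bool" where
  "constant_width K \<longleftrightarrow>
     (\<exists>w. \<forall>u. norm u = 1 \<longrightarrow> support_function K u + support_function K (- u) = w)"

definition centrally_symmetric :: "'a::euclidean_space set \<Rightarrow> bool" where
  "centrally_symmetric K \<longleftrightarrow> (\<exists>c. (\<lambda>x. 2 *\<^sub>R c - x) ` K = K)"

definition euclidean_ball :: "'a::euclidean_space set \<Rightarrow> bool" where
  "euclidean_ball K \<longleftrightarrow> (\<exists>c r. 0 < r \<and> K = cball c r)"

text \<open>The orthogonal projection \<open>K|P\<close>: the points \<open>y\<close> of \<open>P\<close> which are the foot of the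
  perpendicular to \<open>P\<close> from some point \<open>x\<close> of \<open>K\<close>.\<close>

definition proj_onto :: "'a::euclidean_space set \<Rightarrow> 'a set \<Rightarrow> 'a set" where
  "proj_onto K P = {y \<in> P. \<exists>x\<in>K. x - y \<in> P\<^sup>\<bottom>}"

text \<open>Rotation of a two-dimensional subspace \<open>P\<close> by the angle \<open>\<theta>\<close>: in some orthonormal basis
  \<open>u, v\<close> of \<open>P\<close> the map has the standard rotation matrix. Since \<open>P\<close> carries no preferred
  orientation, the angle is determined only up to sign. The values of \<open>\<phi>\<close> outside \<open>P\<close> are
  unconstrained.\<close>

definition rotation_of_plane :: "'a::euclidean_space set \<Rightarrow> real \<Rightarrow> ('a \<Rightarrow> 'a) \<Rightarrow> bool" where
  "rotation_of_plane P \<theta> \<phi> \<longleftrightarrow>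
     (\<exists>u v. norm u = 1 \<and> norm v = 1 \<and> orthogonal u v \<and> span {u, v} = P \<and>
        (\<forall>a b. \<phi> (a *\<^sub>R u + b *\<^sub>R v) =
           (a * cos \<theta> - b * sin \<theta>) *\<^sub>R u + (a * sin \<theta> + b * cos \<theta>) *\<^sub>R v))"

definition rotationally_symmetric :: "nat \<Rightarrow> 'a::euclidean_space set \<Rightarrow> 'a set \<Rightarrow> bool" where
  "rotationally_symmetric q P S \<longleftrightarrow>
     (\<exists>\<phi> b. rotation_of_plane P (2 * pi / real q) \<phi> \<and> b \<in> P \<and> (\<lambda>x. \<phi> x + b) ` S = S)"

end

theory Submission
  imports Defs
begin

text \<open>
  Everything is read off the support function \<open>h\<close> of \<open>K\<close>, because the support function of \<open>K|P\<close>
  is the restriction of \<open>h\<close> to \<open>P\<close>.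

  \<^bold>\<open>Symmetric projections force a ball.\<close>  A \<open>q\<close>-fold symmetry of \<open>K|P\<close> says that \<open>h\<close> on the unit
  circle of \<open>P\<close> changes only by a linear function under the turn by \<open>2\<pi>/q\<close>. Hence its \<open>k\<close>-th Fourier
  coefficient vanishes unless \<open>q\<close> divides \<open>k\<close> or \<open>k = 1\<close>. As \<open>q \<ge> 4\<close>, the frequencies 2 and 3 are
  absent on every great circle, and this no longer mentions \<open>q\<close> (\<open>symmetric_projections_lack_frequency\<close>).
  These two linear conditions are strong enough: an even function without frequency 2 on great
  circles is constant on the sphere, and an odd homogeneous one without frequency 3 is linear.
  So \<open>h u = c + p \<bullet> u\<close> on unit vectors, the support function of the ball of radius \<open>c\<close> about \<open>p\<close>.

  For both implications fix a pole \<open>e\<close> and average over the rotations about \<open>e\<close> in a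
  three-dimensional subspace. The condition is linear and invariant under rotations, so the average
  satisfies it as well. The average is zonal, a function \<open>F t\<close> of the height \<open>t\<close> alone, and a
  great circle whose highest point has height \<open>s\<close> gives
  \<open>\<integral> F (s * cos \<theta>) * cos (k * \<theta>) d\<theta> = 0\<close> for all \<open>s\<close> in \<open>[0, 1]\<close>. This integral equation of Abel type
  is inverted by integrating over \<open>s = sin \<psi>\<close> (\<open>zonal_identity\<close>), after which differentiation leaves an
  ordinary differential equation (\<open>zonal_injective\<close>). The outcome is a mean value property: the mean
  of the function over the circle of latitude \<open>t\<close> about \<open>e\<close> is its value at \<open>e\<close> in the even case, and
  \<open>t\<close> times that value in the odd case.

  In the even case the maximum principle finishes the proof. In the odd case, integrate
  \<open>f x * (x \<bullet> e)\<close> against a radial weight on \<open>\<real>\<^sup>3\<close>. Rotating about \<open>e\<close> first, the mean value property turns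
  this integral into a positive constant times \<open>f e\<close>, whereas the integral is visibly linear in \<open>e\<close>.

  \<^bold>\<open>Threefold symmetry does not.\<close>  Perturb the unit ball by a cubic form:
  \<open>h u = 1 + (u \<bullet> e)\<^sup>3 / 16\<close> for unit vectors \<open>u\<close>. On each great circle a cubic form has only the
  frequencies 1 and 3. The turn by \<open>2\<pi>/3\<close> leaves the latter unchanged, and the former is absorbed by a
  translation. The perturbation is odd, so the width is constant. It is not linear, so there is no centre
  of symmetry. The coefficient \<open>1/16\<close> is small enough for \<open>h\<close> to be the support function of a strictly
  convex body (\<open>cubic_support_point_bounds\<close>).
\<close>

section \<open>Fourier coefficients of periodic functions\<close>

lemma integral_periodic_shift:
  fixes f :: "real \<Rightarrow> 'a::banach"
  assumes cont: "continuous_on UNIV f" and per: "\<And>x. f (x + 2*pi) = f x"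
  shows "integral {0..2*pi} (\<lambda>x. f (x + a)) = integral {0..2*pi} f"
proof -
  interpret periodic_fun_simple f "2*pi" by standard (rule per)
  have int: "f integrable_on {c..d}" for c d
    by (rule integrable_continuous_interval) (rule continuous_on_subset[OF cont], simp)
  define k where "k = \<lfloor>a / (2*pi)\<rfloor>"
  define r where "r = a - of_int k * (2*pi)"
  have "of_int k \<le> a / (2*pi)" "a / (2*pi) < of_int k + 1"
    unfolding k_def by linarith+
  then have r: "0 \<le> r" "r \<le> 2*pi"
    by (auto simp: r_def field_simps)
  have "f (x + a) = f (x + r)" for x
    using plus_of_int[of "x + r" k] by (simp add: r_def algebra_simps)
  then have "integral {0..2*pi} (\<lambda>x. f (x + a)) = integral {0..2*pi} (\<lambda>x. f (x + r))"
    by simp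
  also have "\<dots> = integral {r..2*pi+r} f"
    using integral_shift_real_ivl[of r r "2*pi+r" f] by simp
  also have "\<dots> = integral {r..2*pi} f + integral {2*pi..2*pi+r} f"
    using r by (subst Henstock_Kurzweil_Integration.integral_combine) (auto intro: int)
  also have "integral {2*pi..2*pi+r} f = integral {0..r} (\<lambda>x. f (x + 2*pi))"
    using integral_shift_real_ivl[of "2*pi" "2*pi" "2*pi+r" f] by simp
  also have "\<dots> = integral {0..r} f" by (simp add: per)
  also have "integral {r..2*pi} f + integral {0..r} f = integral {0..2*pi} f"
    using r Henstock_Kurzweil_Integration.integral_combine[of 0 r "2*pi" f] int by (simp add: add.commute)
  finally show ?thesis .
qed

text \<open>Shifting the variable by \<open>\<pi>/m\<close> changes the sign of the integrand but not the integral.\<close>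

lemma integral_cis_eq_0:
  fixes m :: int
  assumes "m \<noteq> 0"
  shows "integral {0..2*pi} (\<lambda>x. cis (of_int m * x)) = 0"
proof -
  let ?I = "integral {0..2*pi} (\<lambda>x. cis (of_int m * x))"
  have per: "cis (of_int m * (x + 2*pi)) = cis (of_int m * x)" for x
  proof -
    have "cis (of_int m * (x + 2*pi)) = cis (of_int m * x) * cis (2 * pi * of_int m)"
      by (simp add: cis_mult algebra_simps)
    then show ?thesis by (simp add: cis_multiple_2pi)
  qed
  have "?I = integral {0..2*pi} (\<lambda>x. cis (of_int m * (x + pi / of_int m)))"
    by (rule integral_periodic_shift[symmetric]) (auto intro!: continuous_intros per)
  also have "\<dots> = integral {0..2*pi} (\<lambda>x. - cis (of_int m * x))"
    using assms by (intro arg_cong[where f="integral _"] ext)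
       (auto simp: distrib_left cis_mult[symmetric])
  also have "\<dots> = - ?I" by simp
  finally show ?thesis by simp
qed

lemma has_integral_cis:
  fixes m :: int
  assumes "m \<noteq> 0"
  shows "((\<lambda>x. cis (of_int m * x)) has_integral 0) {0..2*pi}"
proof -
  have "(\<lambda>x. cis (of_int m * x)) integrable_on {0..2*pi}"
    by (intro integrable_continuous_interval continuous_intros)
  then show ?thesis using integral_cis_eq_0[OF assms] by (metis integrable_integral)
qed

lemma has_integral_cos_cis:
  fixes k :: nat
  assumes "k \<ge> 2"
  shows "((\<lambda>x. of_real (cos x) * cis (k * x)) has_integral 0) {0..2*pi}"
    and "((\<lambda>x. of_real (sin x) * cis (k * x)) has_integral 0) {0..2*pi}"
proof -
  have 1: "((\<lambda>x. cis (of_int (int k + 1) * x)) has_integral 0) {0..2*pi}"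
    and 2: "((\<lambda>x. cis (of_int (int k - 1) * x)) has_integral 0) {0..2*pi}"
    using assms has_integral_cis[of "int k + 1"] has_integral_cis[of "int k - 1"] by simp_all
  have c: "of_real (cos x) * cis (k * x)
      = 1/2 * cis (of_int (int k + 1) * x) + 1/2 * cis (of_int (int k - 1) * x)"
    and s: "of_real (sin x) * cis (k * x)
      = (-\<i>/2) * cis (of_int (int k + 1) * x) + (\<i>/2) * cis (of_int (int k - 1) * x)" for x :: real
    by (auto simp: complex_eq_iff field_simps cos_add sin_add cos_diff sin_diff)
  show "((\<lambda>x. of_real (cos x) * cis (k * x)) has_integral 0) {0..2*pi}"
    unfolding c
    using has_integral_add[OF has_integral_mult_right[OF 1, of "1/2"] has_integral_mult_right[OF 2, of "1/2"]] by simp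
  show "((\<lambda>x. of_real (sin x) * cis (k * x)) has_integral 0) {0..2*pi}"
    unfolding s
    using has_integral_add[OF has_integral_mult_right[OF 1, of "-\<i>/2"] has_integral_mult_right[OF 2, of "\<i>/2"]] by simp
qed

text \<open>The shift by \<open>\<theta>\<close> multiplies the \<open>k\<close>-th Fourier coefficient by \<open>cis (k * \<theta>)\<close>, while the correction
  \<open>\<beta> * cos x + \<gamma> * sin x\<close> lives in frequency 1 and does not contribute. So the coefficient equals itself
  times a number different from 1.\<close>

lemma fourier_coefficient_eq_0:
  fixes p :: "real \<Rightarrow> real" and k :: nat and \<theta> \<beta> \<gamma> :: real
  assumes cont: "continuous_on UNIV p" and per: "\<And>x. p (x + 2*pi) = p x"
    and sym: "\<And>x. p x = p (x - \<theta>) + \<beta> * cos x + \<gamma> * sin x"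
    and k: "k \<ge> 2" and \<theta>: "cis (k * \<theta>) \<noteq> 1"
  shows "integral {0..2*pi} (\<lambda>x. p x * cos (k * x)) = 0"
proof -
  define g where "g x = of_real (p x) * cis (k * x)" for x :: real
  have contg: "continuous_on UNIV g"
    unfolding g_def by (intro continuous_intros cont)
  have perg: "g (x + 2*pi) = g x" for x
  proof -
    have "cis (k * (x + 2*pi)) = cis (k * x) * cis (2 * pi * k)"
      by (simp add: cis_mult algebra_simps)
    then show ?thesis by (simp add: g_def per cis_multiple_2pi)
  qed
  have intg: "g integrable_on {0..2*pi}"
    by (rule integrable_continuous_interval) (rule continuous_on_subset[OF contg], simp)
  have "g (x - \<theta>) = cis (- (k * \<theta>)) * (of_real (p (x - \<theta>)) * cis (k * x))" for x :: real
    by (simp add: g_def cis_mult algebra_simps)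
  then have eq: "of_real (p (x - \<theta>)) * cis (k * x) = cis (k * \<theta>) * g (x - \<theta>)" for x :: real
    by (simp add: cis_mult flip: mult.assoc)
  have gx: "g x = cis (k * \<theta>) * g (x - \<theta>)
      + (of_real \<beta> * (of_real (cos x) * cis (k * x)) + of_real \<gamma> * (of_real (sin x) * cis (k * x)))" for x :: real
    unfolding eq[symmetric] unfolding g_def by (subst sym) (simp add: algebra_simps)
  have "((\<lambda>x. g (x - \<theta>)) has_integral integral {0..2*pi} g) {0..2*pi}"
  proof -
    have "(\<lambda>x. g (x - \<theta>)) integrable_on {0..2*pi}"
      by (rule integrable_continuous_interval)
         (rule continuous_on_compose2[OF contg], auto intro!: continuous_intros)
    moreover have "integral {0..2*pi} (\<lambda>x. g (x - \<theta>)) = integral {0..2*pi} g"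
      using integral_periodic_shift[OF contg perg, of "-\<theta>"] by simp
    ultimately show ?thesis by (metis integrable_integral)
  qed
  from has_integral_add[OF has_integral_mult_right[OF this, of "cis (k*\<theta>)"]
      has_integral_add[OF has_integral_mult_right[OF has_integral_cos_cis(1)[OF k]]
        has_integral_mult_right[OF has_integral_cos_cis(2)[OF k]]], of \<beta> \<gamma>]
  have "(g has_integral cis (k * \<theta>) * integral {0..2*pi} g) {0..2*pi}"
    unfolding gx[symmetric] by simp
  then have "integral {0..2*pi} g = cis (k * \<theta>) * integral {0..2*pi} g"
    by (rule integral_unique)
  then have "integral {0..2*pi} g = 0" using \<theta> by auto
  then have "(g has_integral 0) {0..2*pi}" using intg by (metis integrable_integral)
  from has_integral_linear[OF this bounded_linear_Re]
  have "((\<lambda>x. p x * cos (k * x)) has_integral 0) {0..2*pi}"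
    by (simp add: o_def g_def)
  then show ?thesis by (rule integral_unique)
qed

section \<open>Zonal functions on great circles\<close>

lemma power_two_mult_add:
  fixes y :: real
  shows "y ^ (2 * m + 1) = y * y ^ (2 * m)" "y ^ (2 * m + 2) = y * y * y ^ (2 * m)"
    "y ^ (2 * m + 3) = y * y * y * y ^ (2 * m)"
  by (simp_all add: eval_nat_numeral)

text \<open>Integration of the derivative of \<open>sin x * cos x ^ (2 * m + 1)\<close>.\<close>

lemma wallis_cos_rec:
  "(2 * real m + 2) * integral {0..2*pi} (\<lambda>x. cos x ^ (2 * m + 2))
     = (2 * real m + 1) * integral {0..2*pi} (\<lambda>x. cos x ^ (2 * m))"
proof -
  have "((\<lambda>x. (2 * real m + 2) * cos x ^ (2 * m + 2) - (2 * real m + 1) * cos x ^ (2 * m)) has_integral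
      sin (2*pi) * cos (2*pi) ^ (2 * m + 1) - sin 0 * cos 0 ^ (2 * m + 1)) {0..2*pi}"
  proof (rule fundamental_theorem_of_calculus)
    fix x :: real
    have s: "sin x * sin x = 1 - cos x * cos x"
      using sin_squared_eq[of x] by (simp add: power2_eq_square)
    have "((\<lambda>x. sin x * cos x ^ (2 * m + 1)) has_real_derivative
        cos x * cos x ^ (2 * m + 1) + ((2 * real m + 1) * cos x ^ (2 * m) * - sin x) * sin x) (at x within {0..2*pi})"
      by (rule DERIV_mult, (auto intro!: derivative_eq_intros)[1], rule derivative_eq_intros,
          rule DERIV_subset[OF DERIV_cos], auto)
    moreover have "cos x * cos x ^ (2 * m + 1) + ((2 * real m + 1) * cos x ^ (2 * m) * - sin x) * sin x
        = cos x * cos x ^ (2 * m + 1) - (2 * real m + 1) * cos x ^ (2 * m) * (sin x * sin x)"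
      by simp
    moreover have "\<dots> = (2 * real m + 2) * cos x ^ (2 * m + 2) - (2 * real m + 1) * cos x ^ (2 * m)"
      unfolding s power_two_mult_add by (simp add: algebra_simps del: power_mult power_even_eq)
    ultimately show "((\<lambda>x. sin x * cos x ^ (2 * m + 1)) has_vector_derivative
        (2 * real m + 2) * cos x ^ (2 * m + 2) - (2 * real m + 1) * cos x ^ (2 * m)) (at x within {0..2*pi})"
      unfolding has_real_derivative_iff_has_vector_derivative[symmetric] by metis
  qed simp
  then have "integral {0..2*pi} (\<lambda>x. (2 * real m + 2) * cos x ^ (2 * m + 2) - (2 * real m + 1) * cos x ^ (2 * m)) = 0"
    by (auto dest!: integral_unique)
  moreover have "(\<lambda>x. (2 * real m + 2) * cos x ^ (2 * m + 2)) integrable_on {0..2*pi}"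
     "(\<lambda>x. (2 * real m + 1) * cos x ^ (2 * m)) integrable_on {0..2*pi}"
    by (intro integrable_continuous_interval continuous_intros)+
  ultimately show ?thesis by (subst (asm) integral_diff) simp_all
qed

text \<open>Integration of the derivative of \<open>- cos x * sin x ^ (2 * m + 2)\<close>.\<close>

lemma wallis_sin_rec:
  "(2 * real m + 3) * integral {0..pi} (\<lambda>x. sin x ^ (2 * m + 3))
     = (2 * real m + 2) * integral {0..pi} (\<lambda>x. sin x ^ (2 * m + 1))"
proof -
  have "((\<lambda>x. (2 * real m + 3) * sin x ^ (2 * m + 3) - (2 * real m + 2) * sin x ^ (2 * m + 1)) has_integral
      (- cos pi) * sin pi ^ (2 * m + 2) - (- cos 0) * sin 0 ^ (2 * m + 2)) {0..pi}"
  proof (rule fundamental_theorem_of_calculus)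
    fix x :: real
    have c: "cos x * cos x = 1 - sin x * sin x"
      using cos_squared_eq[of x] by (simp add: power2_eq_square)
    have "((\<lambda>x. (- cos x) * sin x ^ (2 * m + 2)) has_real_derivative
        sin x * sin x ^ (2 * m + 2) + ((2 * real m + 2) * sin x ^ (2 * m + 1) * cos x) * (- cos x)) (at x within {0..pi})"
      by (rule DERIV_mult, (auto intro!: derivative_eq_intros)[1], rule derivative_eq_intros,
          rule DERIV_subset[OF DERIV_sin], auto)
    moreover have "sin x * sin x ^ (2 * m + 2) + ((2 * real m + 2) * sin x ^ (2 * m + 1) * cos x) * (- cos x)
        = sin x * sin x ^ (2 * m + 2) - (2 * real m + 2) * sin x ^ (2 * m + 1) * (cos x * cos x)"
      by simp
    moreover have "\<dots> = (2 * real m + 3) * sin x ^ (2 * m + 3) - (2 * real m + 2) * sin x ^ (2 * m + 1)"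
      unfolding c power_two_mult_add by (simp add: algebra_simps)
    ultimately show "((\<lambda>x. (- cos x) * sin x ^ (2 * m + 2)) has_vector_derivative
        (2 * real m + 3) * sin x ^ (2 * m + 3) - (2 * real m + 2) * sin x ^ (2 * m + 1)) (at x within {0..pi})"
      unfolding has_real_derivative_iff_has_vector_derivative[symmetric] by metis
  qed simp
  then have "integral {0..pi} (\<lambda>x. (2 * real m + 3) * sin x ^ (2 * m + 3) - (2 * real m + 2) * sin x ^ (2 * m + 1)) = 0"
    by (auto dest!: integral_unique)
  moreover have "(\<lambda>x. (2 * real m + 3) * sin x ^ (2 * m + 3)) integrable_on {0..pi}"
     "(\<lambda>x. (2 * real m + 2) * sin x ^ (2 * m + 1)) integrable_on {0..pi}"
    by (intro integrable_continuous_interval continuous_intros)+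
  ultimately show ?thesis by (subst (asm) integral_diff) simp_all
qed

text \<open>The recursions telescope in the product. This is what makes the integral operator of
  \<open>zonal_identity\<close> multiply even monomials by rational multiples of \<open>\<pi>\<close>.\<close>

lemma wallis_product:
  "integral {0..2*pi} (\<lambda>x. cos x ^ (2 * m)) * integral {0..pi} (\<lambda>x. sin x ^ (2 * m + 1))
     = 4 * pi / (2 * real m + 1)"
proof (induction m)
  case 0
  have "(sin has_integral - cos pi - - cos 0) {0..pi}"
    by (rule fundamental_theorem_of_calculus)
       (auto intro!: derivative_eq_intros simp flip: has_real_derivative_iff_has_vector_derivative)
  then have "integral {0..pi} sin = 2" by (simp add: integral_unique)
  then show ?case by simp
next
  case (Suc m)
  let ?W = "\<lambda>m. integral {0..2*pi} (\<lambda>x. cos x ^ (2 * m))"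
  let ?V = "\<lambda>m. integral {0..pi} (\<lambda>x. sin x ^ (2 * m + 1))"
  have cancel: "(a / b * w) * (b / c * v) = a / c * (w * v)" if "b \<noteq> 0" for a b c v w :: real
    using that by simp
  have W: "?W (Suc m) = (2 * real m + 1) / (2 * real m + 2) * ?W m"
    using wallis_cos_rec[of m] by (simp add: field_simps)
  have "?V (Suc m) = integral {0..pi} (\<lambda>x. sin x ^ (2 * m + 3))"
    by (simp add: eval_nat_numeral)
  also have "\<dots> = (2 * real m + 2) / (2 * real m + 3) * ?V m"
    using wallis_sin_rec[of m] by (simp add: field_simps)
  finally have V: "?V (Suc m) = (2 * real m + 2) / (2 * real m + 3) * ?V m" .
  have "?W (Suc m) * ?V (Suc m) = (2 * real m + 1) / (2 * real m + 3) * (?W m * ?V m)"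
    unfolding W V by (rule cancel) simp
  also have "\<dots> = 4 * pi / (2 * real m + 3)"
    unfolding Suc.IH by simp
  finally show ?case by (simp add: algebra_simps)
qed

lemma zonal_identity_monomial:
  fixes \<alpha> \<beta> :: real
  shows "((\<lambda>x. (sin (fst x) * cos (snd x)) ^ (2*m) * (\<alpha> * (cos (snd x))\<^sup>2 - \<beta>) * sin (fst x))
     has_integral 4 * pi * (\<alpha> / (2 * real m + 2) - \<beta> / (2 * real m + 1))) (cbox (0, 0) (pi, 2 * pi))"
proof -
  let ?W = "\<lambda>m. integral {0..2*pi} (\<lambda>x. cos x ^ (2 * m))"
  let ?V = "\<lambda>m. integral {0..pi} (\<lambda>x. sin x ^ (2 * m + 1))"
  let ?f = "\<lambda>x::real\<times>real. (sin (fst x) * cos (snd x)) ^ (2*m) * (\<alpha> * (cos (snd x))\<^sup>2 - \<beta>) * sin (fst x)"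
  have cancel: "(\<alpha> * c / d - \<beta>) * (4 * pi / c) = 4 * pi * (\<alpha> / d - \<beta> / c)"
    if "c \<noteq> 0" "d \<noteq> 0" for c d :: real
    using that by (simp add: field_simps)
  have cont: "continuous_on (cbox (0, 0) (pi, 2 * pi)) ?f"
    by (intro continuous_intros)
  have W: "?W (Suc m) = (2 * real m + 1) / (2 * real m + 2) * ?W m"
    using wallis_cos_rec[of m] by (simp add: field_simps)
  have inner: "integral {0..2*pi} (\<lambda>y. ?f (x, y)) = sin x ^ (2*m+1) * ((\<alpha> * (2 * real m + 1) / (2 * real m + 2) - \<beta>) * ?W m)" for x
  proof -
    have "integral {0..2*pi} (\<lambda>y. ?f (x, y))
        = integral {0..2*pi} (\<lambda>y. sin x ^ (2*m+1) * (\<alpha> * cos y ^ (2 * Suc m) - \<beta> * cos y ^ (2*m)))"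
      by (intro arg_cong[where f="integral _"] ext) (simp add: algebra_simps power2_eq_square)
    also have "\<dots> = sin x ^ (2*m+1) * (\<alpha> * ?W (Suc m) - \<beta> * ?W m)"
      by (subst integral_mult_right, subst integral_diff)
         (auto intro!: integrable_continuous_interval continuous_intros)
    also have "\<dots> = sin x ^ (2*m+1) * ((\<alpha> * (2 * real m + 1) / (2 * real m + 2) - \<beta>) * ?W m)"
      unfolding W by (simp add: algebra_simps)
    finally show ?thesis .
  qed
  have "integral (cbox (0, 0) (pi, 2 * pi)) ?f = integral {0..pi} (\<lambda>x. integral {0..2*pi} (\<lambda>y. ?f (x, y)))"
    using integral_prod_continuous[OF cont] by simp
  also have "\<dots> = ?V m * ((\<alpha> * (2 * real m + 1) / (2 * real m + 2) - \<beta>) * ?W m)"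
    unfolding inner by (rule integral_mult_left)
  also have "\<dots> = (\<alpha> * (2 * real m + 1) / (2 * real m + 2) - \<beta>) * (?W m * ?V m)"
    by simp
  also have "\<dots> = (\<alpha> * (2 * real m + 1) / (2 * real m + 2) - \<beta>) * (4 * pi / (2 * real m + 1))"
    unfolding wallis_product ..
  also have "\<dots> = 4 * pi * (\<alpha> / (2 * real m + 2) - \<beta> / (2 * real m + 1))"
    by (rule cancel) simp_all
  finally show ?thesis
    using integrable_integral[OF integrable_continuous[OF cont]] by (simp only:)
qed

lemma has_integral_monomial_01:
  fixes \<alpha> \<beta> :: real
  shows "((\<lambda>t. t ^ (2*m) * (\<alpha> * t - \<beta>)) has_integral (\<alpha> / (2 * real m + 2) - \<beta> / (2 * real m + 1))) {0..1}"
proof -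
  have pow: "((\<lambda>t. t ^ n) has_integral 1 / (real n + 1)) {0..1}" for n
  proof -
    have "((\<lambda>t. t ^ n) has_integral 1 ^ Suc n / (real n + 1) - 0 ^ Suc n / (real n + 1)) {0..1::real}"
    proof (rule fundamental_theorem_of_calculus)
      fix t :: real
      have "((\<lambda>t. t ^ Suc n / (real n + 1)) has_real_derivative (1 + real n) * t ^ n / (real n + 1)) (at t within {0..1})"
        by (intro DERIV_cdivide DERIV_subset[OF DERIV_pow, THEN DERIV_cong]) auto
      then show "((\<lambda>t. t ^ Suc n / (real n + 1)) has_vector_derivative t ^ n) (at t within {0..1})"
        by (simp add: has_real_derivative_iff_has_vector_derivative add.commute)
    qed simp
    then show ?thesis by simp
  qed
  have "((\<lambda>t. \<alpha> * t ^ (2*m+1) - \<beta> * t ^ (2*m)) has_integral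
      \<alpha> * (1 / (real (2*m+1) + 1)) - \<beta> * (1 / (real (2*m) + 1))) {0..1}"
    by (intro has_integral_diff has_integral_mult_right pow)
  then show ?thesis by (simp add: algebra_simps)
qed

text \<open>With \<open>sin \<psi> * cos \<theta>\<close> as height on the sphere, the double integral is a spherical integral in polar
  coordinates about an axis orthogonal to the pole. The mean of \<open>cos \<theta> ^ 2\<close> over the circle of height \<open>t \<ge> 0\<close> is \<open>t\<close>,
  and heights are uniformly distributed by Archimedes, which explains the right-hand side. Instead
  of changing variables, the proof checks the identity on even monomials and extends it by
  the Weierstrass approximation theorem: both sides are bounded linear functionals of \<open>G\<close>.\<close>

lemma zonal_identity:
  fixes G :: "real \<Rightarrow> real" and \<alpha> \<beta> :: real
  assumes cont: "continuous_on UNIV G" and even: "\<And>t. G (- t) = G t"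
  shows "integral (cbox (0, 0) (pi, 2 * pi))
           (\<lambda>x. G (sin (fst x) * cos (snd x)) * (\<alpha> * (cos (snd x))\<^sup>2 - \<beta>) * sin (fst x))
         = 4 * pi * integral {0..1} (\<lambda>t. G t * (\<alpha> * t - \<beta>))"
proof -
  let ?Q = "cbox (0, 0) (pi, 2 * pi) :: (real \<times> real) set"
  define L2 where "L2 g x = g (sin (fst x) * cos (snd x)) * (\<alpha> * (cos (snd x))\<^sup>2 - \<beta>) * sin (fst x)"
    for g :: "real \<Rightarrow> real" and x :: "real \<times> real"
  define L1 where "L1 g t = g t * (\<alpha> * t - \<beta>)" for g :: "real \<Rightarrow> real" and t
  define A where "A = \<bar>\<alpha>\<bar> + \<bar>\<beta>\<bar>"
  have A: "A \<ge> 0" by (simp add: A_def)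
  have w: "\<bar>\<alpha> * t - \<beta>\<bar> \<le> A" if "0 \<le> t" "t \<le> 1" for t
    using that mult_left_le[of t "\<bar>\<alpha>\<bar>"] abs_triangle_ineq4[of "\<alpha>*t" \<beta>] by (simp add: A_def abs_mult)
  have cont1: "L1 g integrable_on {0..1}" if "continuous_on UNIV g" for g
    unfolding L1_def by (intro integrable_continuous_interval continuous_intros continuous_on_subset[OF that]) auto
  have cont2: "L2 g integrable_on ?Q" if "continuous_on UNIV g" for g
    unfolding L2_def
    by (intro integrable_continuous continuous_intros continuous_on_compose2[OF that]) auto
  \<comment> \<open>The summand 1 only ensures \<open>C > 0\<close>, so that \<open>e / C\<close> can be used below.\<close>
  define C where "C = (2 * pi * pi + 4 * pi) * A + 1"
  have C: "C > 0" using A by (auto simp: C_def intro!: add_nonneg_pos mult_nonneg_nonneg)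
  have "\<bar>integral ?Q (L2 G) - 4 * pi * integral {0..1} (L1 G)\<bar> \<le> C * e" if e: "e > 0" for e
  proof -
    \<comment> \<open>Approximating \<open>G (sqrt x)\<close> by polynomials in \<open>x\<close> yields even polynomials near \<open>G\<close>.\<close>
    have "continuous_on {0..1} (\<lambda>x. G (sqrt x))"
      by (intro continuous_on_compose2[OF cont] continuous_intros) auto
    from Stone_Weierstrass_real_polynomial_function[OF _ this e] obtain p where
      p: "real_polynomial_function p" "\<And>x. x \<in> {0..1} \<Longrightarrow> \<bar>G (sqrt x) - p x\<bar> < e"
      by auto
    then obtain c n where pc: "p = (\<lambda>x. \<Sum>i\<le>n. c i * x ^ i)"
      by (auto simp: real_polynomial_function_iff_sum)
    define H where "H t = p (t\<^sup>2)" for t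
    have contH: "continuous_on UNIV H" unfolding H_def pc by (intro continuous_intros)
    have H: "\<bar>G t - H t\<bar> \<le> e" if "\<bar>t\<bar> \<le> 1" for t
    proof -
      have "t\<^sup>2 \<in> {0..1}" using that by (simp add: abs_square_le_1)
      from p(2)[OF this] have "\<bar>G \<bar>t\<bar> - p (t\<^sup>2)\<bar> < e" by simp
      moreover have "G \<bar>t\<bar> = G t" by (simp add: abs_if even)
      ultimately show ?thesis by (simp add: H_def)
    qed
    have H_sum: "H t = (\<Sum>i\<le>n. c i * t ^ (2 * i))" for t
      by (simp add: H_def pc power_mult)
    have "integral ?Q (L2 H) = (\<Sum>i\<le>n. c i * (4 * pi * (\<alpha> / (2 * real i + 2) - \<beta> / (2 * real i + 1))))"
      by (rule integral_unique)
         (use has_integral_sum[OF _ has_integral_mult_right[OF zonal_identity_monomial], of "{..n}" c]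
         in \<open>simp add: L2_def[abs_def] H_sum sum_distrib_right mult.assoc\<close>)
    moreover have "integral {0..1} (L1 H) = (\<Sum>i\<le>n. c i * (\<alpha> / (2 * real i + 2) - \<beta> / (2 * real i + 1)))"
      by (rule integral_unique)
         (use has_integral_sum[OF _ has_integral_mult_right[OF has_integral_monomial_01], of "{..n}" c]
         in \<open>simp add: L1_def[abs_def] H_sum sum_distrib_right mult.assoc\<close>)
    ultimately have LH: "integral ?Q (L2 H) = 4 * pi * integral {0..1} (L1 H)"
      by (simp add: sum_distrib_left algebra_simps)
    have "norm (integral ?Q (\<lambda>x. L2 G x - L2 H x)) \<le> (A * e) * measure lborel ?Q"
    proof (rule has_integral_bound[OF _ integrable_integral])
      show "(\<lambda>x. L2 G x - L2 H x) integrable_on ?Q"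
        by (intro integrable_diff cont2 cont contH)
      fix x :: "real \<times> real"
      assume "x \<in> ?Q"
      have "\<bar>G (sin (fst x) * cos (snd x)) - H (sin (fst x) * cos (snd x))\<bar> \<le> e"
        by (rule H) (auto simp: abs_mult intro!: mult_le_one)
      moreover have "\<bar>\<alpha> * (cos (snd x))\<^sup>2 - \<beta>\<bar> \<le> A" by (rule w) (auto simp: abs_square_le_1)
      ultimately have "\<bar>G (sin (fst x) * cos (snd x)) - H (sin (fst x) * cos (snd x))\<bar> * \<bar>\<alpha> * (cos (snd x))\<^sup>2 - \<beta>\<bar> * \<bar>sin (fst x)\<bar> \<le> e * A * 1" (is "?l \<le> _")
        using e A by (intro mult_mono) auto
      moreover have "L2 G x - L2 H x = (G (sin (fst x) * cos (snd x)) - H (sin (fst x) * cos (snd x))) * (\<alpha> * (cos (snd x))\<^sup>2 - \<beta>) * sin (fst x)"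
        by (simp add: L2_def left_diff_distrib)
      then have "norm (L2 G x - L2 H x) = ?l" by (simp only: real_norm_def abs_mult)
      ultimately show "norm (L2 G x - L2 H x) \<le> A * e" by (simp add: mult.commute)
    qed (use A e in auto)
    then have 2: "\<bar>integral ?Q (L2 G) - integral ?Q (L2 H)\<bar> \<le> (A * e) * (2 * pi * pi)"
      by (subst (asm) integral_diff[OF cont2[OF cont] cont2[OF contH]]) (simp add: content_Pair algebra_simps)
    have "norm (integral {0..1} (\<lambda>x. L1 G x - L1 H x)) \<le> (A * e) * (1 - 0)"
    proof (rule integral_bound)
      show "continuous_on {0..1} (\<lambda>x. L1 G x - L1 H x)"
        unfolding L1_def
        by (intro continuous_intros continuous_on_subset[OF cont] continuous_on_subset[OF contH]) auto
      fix x :: real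
      assume x: "x \<in> {0..1}"
      then have "\<bar>G x - H x\<bar> * \<bar>\<alpha> * x - \<beta>\<bar> \<le> e * A"
        using e A by (intro mult_mono H w) auto
      moreover have "L1 G x - L1 H x = (G x - H x) * (\<alpha> * x - \<beta>)"
        by (simp add: L1_def left_diff_distrib)
      then have "norm (L1 G x - L1 H x) = \<bar>G x - H x\<bar> * \<bar>\<alpha> * x - \<beta>\<bar>"
        by (simp only: real_norm_def abs_mult)
      ultimately show "norm (L1 G x - L1 H x) \<le> A * e" by (simp add: mult.commute)
    qed simp
    then have 1: "\<bar>integral {0..1} (L1 G) - integral {0..1} (L1 H)\<bar> \<le> A * e"
      by (subst (asm) integral_diff[OF cont1[OF cont] cont1[OF contH]]) simp
    have "\<bar>integral ?Q (L2 G) - 4 * pi * integral {0..1} (L1 G)\<bar>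
        \<le> \<bar>integral ?Q (L2 G) - integral ?Q (L2 H)\<bar> + 4 * pi * \<bar>integral {0..1} (L1 G) - integral {0..1} (L1 H)\<bar>"
    proof -
      have "4 * pi * \<bar>integral {0..1} (L1 G) - integral {0..1} (L1 H)\<bar> = \<bar>4 * pi * integral {0..1} (L1 G) - integral ?Q (L2 H)\<bar>"
        unfolding LH right_diff_distrib[symmetric] abs_mult by simp
      then show ?thesis by linarith
    qed
    also have "\<dots> \<le> (A * e) * (2 * pi * pi) + 4 * pi * (A * e)"
      using 1 2 by (intro add_mono mult_left_mono) auto
    also have "\<dots> \<le> C * e" using e by (simp add: C_def algebra_simps)
    finally show ?thesis .
  qed
  from this[of "_ / C"] have "\<bar>integral ?Q (L2 G) - 4 * pi * integral {0..1} (L1 G)\<bar> \<le> 0 + e" if "e > 0" for e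
    using that C by (simp add: field_simps)
  then have "\<bar>integral ?Q (L2 G) - 4 * pi * integral {0..1} (L1 G)\<bar> \<le> 0"
    by (rule field_le_epsilon)
  then show ?thesis by (simp add: L1_def[abs_def] L2_def[abs_def])
qed

text \<open>The cases \<open>j = 0\<close> and \<open>j = 2\<close> are used. They correspond to the weights \<open>cos (2 * \<theta>)\<close> and
  \<open>cos (3 * \<theta>) / cos \<theta>\<close>. Averaging the hypothesis over \<open>s * sin \<psi>\<close> with \<open>zonal_identity\<close> removes the circle
  and leaves \<open>\<integral>\<^sub>0\<^sup>1 G (s * t) * ((j + 2) * t - (j + 1)) dt = 0\<close>, a relation between the primitives of \<open>G\<close> and of \<open>t * G t\<close>.\<close>

lemma zonal_injective:
  fixes G :: "real \<Rightarrow> real" and j :: nat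
  assumes cont: "continuous_on UNIV G" and even: "\<And>t. G (- t) = G t"
    and zero: "\<And>s. 0 \<le> s \<Longrightarrow> s \<le> 1 \<Longrightarrow>
       integral {0..2*pi} (\<lambda>x. G (s * cos x) * ((real j + 2) * (cos x)\<^sup>2 - (real j + 1))) = 0"
    and s: "0 < s" "s \<le> 1"
  shows "G s = s ^ j * G 1"
proof -
  define M where "M s = integral {0..s} G" for s
  define N where "N s = integral {0..s} (\<lambda>t. t * G t)" for s
  have rel: "(real j + 2) * N s = (real j + 1) * (s * M s)" if s: "0 < s" "s \<le> 1" for s
  proof -
    let ?Q = "cbox (0, 0) (pi, 2 * pi) :: (real \<times> real) set"
    let ?f = "\<lambda>x. G (s * (sin (fst x) * cos (snd x))) * ((real j + 2) * (cos (snd x))\<^sup>2 - (real j + 1)) * sin (fst x)"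
    have "continuous_on ?Q ?f"
      by (intro continuous_intros continuous_on_compose2[OF cont]) auto
    then have "integral ?Q ?f = integral {0..pi} (\<lambda>x. integral {0..2*pi} (\<lambda>y. ?f (x, y)))"
      using integral_prod_continuous[of 0 0 pi "2*pi" ?f] by simp
    also have "\<dots> = integral {0..pi} (\<lambda>x. 0)"
    proof (rule integral_cong)
      fix x :: real assume "x \<in> {0..pi}"
      then have "0 \<le> sin x" by (simp add: sin_ge_zero)
      then have "0 \<le> s * sin x" "s * sin x \<le> 1"
        using s by (auto intro: mult_le_one)
      from zero[OF this] show "integral {0..2*pi} (\<lambda>y. ?f (x, y)) = 0"
        by (simp add: mult.assoc[of s "sin x"])
    qed
    finally have "integral ?Q ?f = 0" by simp
    moreover have "continuous_on UNIV (\<lambda>t. G (s * t))"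
      by (intro continuous_on_compose2[OF cont] continuous_intros) auto
    ultimately have I: "integral {0..1} (\<lambda>t. G (s * t) * ((real j + 2) * t - (real j + 1))) = 0"
      using zonal_identity[of "\<lambda>t. G (s * t)" "real j + 2" "real j + 1"] by (simp add: even)
    have sub: "((\<lambda>t. s *\<^sub>R (G (s * t) * ((real j + 2) * ((s * t) / s) - (real j + 1)))) has_integral
        integral {s * 0..s * 1} (\<lambda>u. G u * ((real j + 2) * (u / s) - (real j + 1)))) {0..1}"
      using s by (intro has_integral_substitution[where c = 0 and d = s])
        (auto intro!: derivative_eq_intros continuous_intros continuous_on_subset[OF cont] mult_left_le)
    have "integral {0..s} (\<lambda>u. G u * ((real j + 2) * (u / s) - (real j + 1))) = 0"
      using s I integral_unique[OF sub] by simp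
    moreover have "G u * ((real j + 2) * (u / s) - (real j + 1)) = (real j + 2) / s * (u * G u) - (real j + 1) * G u" for u
      by (simp add: algebra_simps add_divide_distrib)
    moreover have "integral {0..s} (\<lambda>u. (real j + 2) / s * (u * G u) - (real j + 1) * G u) = (real j + 2) / s * N s - (real j + 1) * M s"
      using s unfolding N_def M_def
      by (subst integral_diff)
        (auto intro!: integrable_continuous_interval continuous_intros continuous_on_subset[OF cont])
    ultimately show ?thesis using s by (simp add: field_simps)
  qed
  have cont01: "continuous_on {0..1} G" "continuous_on {0..1} (\<lambda>t. t * G t)"
    by (intro continuous_intros continuous_on_subset[OF cont] subset_UNIV)+
  have dM: "(M has_real_derivative G s) (at s within {0..1})" if "0 < s" "s \<le> 1" for s
    unfolding M_def[abs_def] by (rule integral_has_real_derivative[OF cont01(1)]) (use that in simp)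
  have dN: "(N has_real_derivative s * G s) (at s within {0..1})" if "0 < s" "s \<le> 1" for s
    unfolding N_def[abs_def] by (rule integral_has_real_derivative[OF cont01(2)]) (use that in simp)
  \<comment> \<open>Differentiation of \<open>rel\<close>.\<close>
  have rel2: "s * G s = (real j + 1) * M s" if s: "0 < s" "s \<le> 1" for s
  proof -
    have d1: "((\<lambda>s. (real j + 2) * N s) has_real_derivative (real j + 2) * (s * G s)) (at s within {0..1})"
      by (intro DERIV_cmult dN s)
    have d2: "((\<lambda>s. (real j + 1) * (s * M s)) has_real_derivative (real j + 1) * (1 * M s + G s * s)) (at s within {0..1})"
      by (intro DERIV_cmult DERIV_mult DERIV_ident dM s)
    have rel0: "(real j + 2) * N s = (real j + 1) * (s * M s)" if "s \<in> {0..1}" for s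
      using rel[of s] that by (cases "s = 0") (auto simp: N_def)
    have d2': "((\<lambda>s. (real j + 2) * N s) has_real_derivative (real j + 1) * (1 * M s + G s * s)) (at s within {0..1})"
      by (rule has_field_derivative_transform_within[OF d2, of 1]) (use s rel0 in auto)
    have "(real j + 2) * (s * G s) = (real j + 1) * (1 * M s + G s * s)"
      using d1 d2' s vector_derivative_unique_within_closed_interval[of 0 1 s "\<lambda>s. (real j + 2) * N s"]
      by (auto simp: has_real_derivative_iff_has_vector_derivative)
    then show ?thesis by (simp add: algebra_simps)
  qed
  \<comment> \<open>\<open>rel2\<close> is the differential equation \<open>s * M' s = (j + 1) * M s\<close>, whose solutions are multiples of \<open>s ^ (j + 1)\<close>.\<close>
  have "\<exists>c. \<forall>s\<in>{0<..1}. M s / s ^ (j + 1) = c"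
  proof (rule has_field_derivative_zero_constant)
    fix s :: real assume s: "s \<in> {0<..1}"
    then have s': "0 < s" "s \<le> 1" by auto
    have "((\<lambda>s. M s / s ^ (j + 1)) has_real_derivative
        (G s * s ^ (j + 1) - M s * (real (j + 1) * s ^ j)) / (s ^ (j + 1) * s ^ (j + 1))) (at s within {0<..1})"
      using s' by (intro DERIV_divide DERIV_subset[OF dM[OF s']] DERIV_cong[OF DERIV_pow[of "j + 1"]]) auto
    moreover have "G s * s ^ (j + 1) - M s * (real (j + 1) * s ^ j) = s ^ j * (s * G s - (real j + 1) * M s)"
      by (simp add: algebra_simps)
    then have "G s * s ^ (j + 1) - M s * (real (j + 1) * s ^ j) = 0"
      using rel2[OF s'] by simp
    ultimately show "((\<lambda>s. M s / s ^ (j + 1)) has_real_derivative 0) (at s within {0<..1})"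
      by (simp only: div_0)
  qed simp
  then obtain c where "M s / s ^ (j + 1) = c" if "0 < s" "s \<le> 1" for s by auto
  then have M: "M s = c * s ^ (j + 1)" if "0 < s" "s \<le> 1" for s
    using that by (force simp: field_simps)
  have "s * G s = s * (s ^ j * G 1)"
    using rel2[OF s] rel2[of 1] M[OF s] M[of 1] by (simp add: algebra_simps)
  then show ?thesis using s by simp
qed

section \<open>Averages over circles of latitude\<close>

definition orthonormal_triple :: "'a::real_inner \<Rightarrow> 'a \<Rightarrow> 'a \<Rightarrow> bool" where
  "orthonormal_triple e a b \<longleftrightarrow>
     norm e = 1 \<and> norm a = 1 \<and> norm b = 1 \<and> e \<bullet> a = 0 \<and> e \<bullet> b = 0 \<and> a \<bullet> b = 0"

text \<open>Only cosine coefficients are required to vanish. This is no restriction, since the orthonormal frame \<open>u, v\<close> may be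
  rotated in its plane.\<close>

definition lacks_frequency :: "nat \<Rightarrow> ('a::real_inner \<Rightarrow> real) \<Rightarrow> bool" where
  "lacks_frequency k f \<longleftrightarrow>
     (\<forall>u v. norm u = 1 \<and> norm v = 1 \<and> u \<bullet> v = 0 \<longrightarrow>
        integral {0..2*pi} (\<lambda>x. f (cos x *\<^sub>R u + sin x *\<^sub>R v) * cos (real k * x)) = 0)"

text \<open>The integral over the circle of latitude \<open>t\<close> about the pole \<open>e\<close>, for \<open>\<bar>t\<bar> \<le> 1\<close>. Outside this range
  the formula is still continuous in \<open>t\<close>, because \<open>sqrt\<close> is continuous on all reals.\<close>

definition latitude_integral :: "('a::real_inner \<Rightarrow> real) \<Rightarrow> 'a \<Rightarrow> 'a \<Rightarrow> 'a \<Rightarrow> real \<Rightarrow> real" where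
  "latitude_integral f e a b t =
     integral {0..2*pi} (\<lambda>x. f (t *\<^sub>R e + sqrt (1 - t\<^sup>2) *\<^sub>R (cos x *\<^sub>R a + sin x *\<^sub>R b)))"

lemma continuous_on_latitude_integral:
  fixes f :: "'a::real_inner \<Rightarrow> real"
  assumes "continuous_on UNIV f"
  shows "continuous_on UNIV (latitude_integral f e a b)"
proof -
  have "continuous_on (UNIV \<times> cbox 0 (2*pi))
      (\<lambda>(t, x). f (t *\<^sub>R e + sqrt (1 - t\<^sup>2) *\<^sub>R (cos x *\<^sub>R a + sin x *\<^sub>R b)))"
    unfolding split_def
    by (intro continuous_on_compose2[OF assms] continuous_intros) auto
  from integral_continuous_on_param[OF this] show ?thesis
    by (simp add: latitude_integral_def[abs_def])
qed

lemma latitude_integral_pole: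
  "latitude_integral f e a b 1 = 2 * pi * f e"
  by (simp add: latitude_integral_def)

lemma latitude_integral_minus:
  fixes f :: "'a::real_inner \<Rightarrow> real"
  assumes cont: "continuous_on UNIV f"
  shows "latitude_integral f e a b (- t) = latitude_integral (\<lambda>x. f (- x)) e a b t"
proof -
  define g where "g x = f (- t *\<^sub>R e + sqrt (1 - t\<^sup>2) *\<^sub>R (cos x *\<^sub>R a + sin x *\<^sub>R b))" for x
  have "continuous_on UNIV g"
    unfolding g_def by (intro continuous_on_compose2[OF cont] continuous_intros) auto
  moreover have "g (x + 2 * pi) = g x" for x by (simp add: g_def)
  ultimately have "integral {0..2*pi} (\<lambda>x. g (x + pi)) = integral {0..2*pi} g"
    by (rule integral_periodic_shift)
  moreover have "g (x + pi) = f (- (t *\<^sub>R e + sqrt (1 - t\<^sup>2) *\<^sub>R (cos x *\<^sub>R a + sin x *\<^sub>R b)))" for x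
    by (simp add: g_def algebra_simps)
  ultimately show ?thesis
    by (simp add: latitude_integral_def g_def[abs_def])
qed

text \<open>The great circles spanned by \<open>u \<phi>\<close> and \<open>v \<phi>\<close> below arise from one of them by rotation about \<open>e\<close>.
  Averaging the hypothesis over \<open>\<phi>\<close> and exchanging the integrals, the inner integral runs over the whole circle
  of latitude through a point of height \<open>s * cos \<theta>\<close>.\<close>

lemma lacks_frequency_latitude_integral:
  fixes f :: "'a::real_inner \<Rightarrow> real"
  assumes cont: "continuous_on UNIV f" and freq: "lacks_frequency k f"
    and ort: "orthonormal_triple e a b" and s: "0 \<le> s" "s \<le> 1"
  shows "integral {0..2*pi} (\<lambda>\<theta>. latitude_integral f e a b (s * cos \<theta>) * cos (real k * \<theta>)) = 0"
proof -
  define c where "c = sqrt (1 - s\<^sup>2)"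
  have "s\<^sup>2 \<le> 1" using s by (simp add: abs_square_le_1)
  then have c: "c * c = 1 - s * s"
    by (simp add: c_def power2_eq_square)
  have inn: "e \<bullet> e = 1" "a \<bullet> a = 1" "b \<bullet> b = 1" "e \<bullet> a = 0" "e \<bullet> b = 0" "a \<bullet> b = 0"
    "a \<bullet> e = 0" "b \<bullet> e = 0" "b \<bullet> a = 0"
    using ort by (auto simp: orthonormal_triple_def norm_eq_1 inner_commute)
  have trig: "sin \<phi> * sin \<phi> = 1 - cos \<phi> * cos \<phi>" for \<phi> :: real
    using sin_squared_eq[of \<phi>] by (simp add: power2_eq_square)
  define u where "u \<phi> = s *\<^sub>R e + c *\<^sub>R (cos \<phi> *\<^sub>R a + sin \<phi> *\<^sub>R b)" for \<phi>
  define v where "v \<phi> = cos \<phi> *\<^sub>R b - sin \<phi> *\<^sub>R a" for \<phi>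
  have uu: "u \<phi> \<bullet> u \<phi> = 1" for \<phi>
  proof -
    have "u \<phi> \<bullet> u \<phi> = s * s + (c * c) * (cos \<phi> * cos \<phi> + sin \<phi> * sin \<phi>)"
      by (simp add: u_def inner_simps inn algebra_simps del: sin_cos_squared_add3)
    then show ?thesis by (simp add: c trig)
  qed
  have vv: "v \<phi> \<bullet> v \<phi> = 1" for \<phi>
    by (simp add: v_def inner_simps inn trig)
  have uv: "u \<phi> \<bullet> v \<phi> = 0" for \<phi>
    by (simp add: u_def v_def inner_simps inn)
  \<comment> \<open>For fixed \<open>\<theta>\<close> the points \<open>cos \<theta> *\<^sub>R u \<phi> + sin \<theta> *\<^sub>R v \<phi>\<close> traverse that circle of latitude, up to a phase \<open>\<psi>\<close>.\<close>
  have *: "latitude_integral f e a b (s * cos \<theta>)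
      = integral {0..2*pi} (\<lambda>\<phi>. f (cos \<theta> *\<^sub>R u \<phi> + sin \<theta> *\<^sub>R v \<phi>))" for \<theta>
  proof -
    define r where "r = sqrt (1 - (s * cos \<theta>)\<^sup>2)"
    define z where "z = Complex (c * cos \<theta>) (sin \<theta>)"
    have "(c * cos \<theta>)\<^sup>2 + (sin \<theta>)\<^sup>2 = (c * c) * (cos \<theta> * cos \<theta>) + sin \<theta> * sin \<theta>"
      by (simp add: power2_eq_square algebra_simps)
    also have "\<dots> = 1 - (s * cos \<theta>)\<^sup>2"
      unfolding c trig by (simp add: power2_eq_square algebra_simps)
    finally have "cmod z = r"
      by (simp add: z_def r_def cmod_def)
    then have "z = rcis r (Arg z)" using rcis_cmod_Arg[of z] by simp
    then obtain \<psi> where "z = rcis r \<psi>" by blast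
    then have \<psi>: "r * cos \<psi> = c * cos \<theta>" "r * sin \<psi> = sin \<theta>"
      by (auto simp: complex_eq_iff z_def)
    define g where "g \<phi> = f ((s * cos \<theta>) *\<^sub>R e + r *\<^sub>R (cos \<phi> *\<^sub>R a + sin \<phi> *\<^sub>R b))" for \<phi>
    have "continuous_on UNIV g"
      unfolding g_def by (intro continuous_on_compose2[OF cont] continuous_intros) auto
    moreover have "g (x + 2 * pi) = g x" for x by (simp add: g_def)
    ultimately have "integral {0..2*pi} (\<lambda>x. g (x + \<psi>)) = integral {0..2*pi} g"
      by (rule integral_periodic_shift)
    moreover have "g (\<phi> + \<psi>) = f (cos \<theta> *\<^sub>R u \<phi> + sin \<theta> *\<^sub>R v \<phi>)" for \<phi>
    proof -
      have *: "r * cos (\<phi> + \<psi>) = cos \<phi> * (c * cos \<theta>) - sin \<phi> * sin \<theta>"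
        "r * sin (\<phi> + \<psi>) = sin \<phi> * (c * cos \<theta>) + cos \<phi> * sin \<theta>"
        unfolding \<psi>[symmetric] by (simp_all add: cos_add sin_add algebra_simps)
      have "g (\<phi> + \<psi>) = f ((s * cos \<theta>) *\<^sub>R e
          + ((r * cos (\<phi> + \<psi>)) *\<^sub>R a + (r * sin (\<phi> + \<psi>)) *\<^sub>R b))"
        by (simp add: g_def scaleR_add_right)
      then show ?thesis
        unfolding * by (simp add: u_def v_def algebra_simps)
    qed
    ultimately show ?thesis
      by (simp add: latitude_integral_def g_def[abs_def] r_def)
  qed
  have contuv: "continuous_on (cbox (0, 0) (2*pi, 2*pi))
      (\<lambda>(\<theta>, \<phi>). f (cos \<theta> *\<^sub>R u \<phi> + sin \<theta> *\<^sub>R v \<phi>) * cos (real k * \<theta>))"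
    unfolding u_def v_def split_def
    by (intro continuous_intros continuous_on_compose2[OF cont]) auto
  have "integral {0..2*pi} (\<lambda>\<theta>. latitude_integral f e a b (s * cos \<theta>) * cos (real k * \<theta>))
      = integral {0..2*pi} (\<lambda>\<theta>. integral {0..2*pi} (\<lambda>\<phi>. f (cos \<theta> *\<^sub>R u \<phi> + sin \<theta> *\<^sub>R v \<phi>) * cos (real k * \<theta>)))"
    unfolding * by simp
  also have "\<dots> = integral {0..2*pi} (\<lambda>\<phi>. integral {0..2*pi} (\<lambda>\<theta>. f (cos \<theta> *\<^sub>R u \<phi> + sin \<theta> *\<^sub>R v \<phi>) * cos (real k * \<theta>)))"
    using integral_swap_continuous[OF contuv] by simp
  also have "\<dots> = integral {0..2*pi} (\<lambda>\<phi>. 0)"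
    using freq uu vv uv by (simp add: lacks_frequency_def norm_eq_1)
  finally show ?thesis by simp
qed

lemma latitude_integral_even:
  fixes f :: "'a::real_inner \<Rightarrow> real"
  assumes cont: "continuous_on UNIV f" and even: "\<And>x. f (- x) = f x"
    and freq: "lacks_frequency 2 f" and ort: "orthonormal_triple e a b" and t: "0 \<le> t" "t \<le> 1"
  shows "latitude_integral f e a b t = 2 * pi * f e"
proof -
  let ?F = "latitude_integral f e a b"
  have const: "?F t = t ^ 0 * ?F 1" if t: "0 < t" "t \<le> 1" for t
  proof (rule zonal_injective[OF _ _ _ t])
    show "continuous_on UNIV ?F" by (rule continuous_on_latitude_integral[OF cont])
    show "?F (- t) = ?F t" for t by (simp only: latitude_integral_minus[OF cont] even)
    fix s :: real assume s: "0 \<le> s" "s \<le> 1"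
    have "(real 0 + 2) * (cos \<theta>)\<^sup>2 - (real 0 + 1) = cos (real 2 * \<theta>)" for \<theta>
      by (simp add: cos_double_cos)
    then show "integral {0..2*pi} (\<lambda>\<theta>. ?F (s * cos \<theta>) * ((real 0 + 2) * (cos \<theta>)\<^sup>2 - (real 0 + 1))) = 0"
      using lacks_frequency_latitude_integral[OF cont freq ort s] by (simp only: of_nat_numeral)
  qed
  have "?F t = 2 * pi * f e" if "t \<in> {0<..1}" for t
    using that const[of t] by (simp add: latitude_integral_pole)
  moreover have "continuous_on (closure {0<..1}) ?F"
    by (rule continuous_on_subset[OF continuous_on_latitude_integral[OF cont]]) simp
  moreover have "t \<in> closure {0<..1}" using t by simp
  ultimately show ?thesis using continuous_constant_on_closure by blast
qed

text \<open>Here \<open>zonal_injective\<close> is applied to the even function \<open>t * F t\<close>, using the factor \<open>cos \<theta>\<close> of \<open>cos (3 * \<theta>)\<close>.\<close>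

lemma latitude_integral_odd:
  fixes f :: "'a::real_inner \<Rightarrow> real"
  assumes cont: "continuous_on UNIV f" and odd: "\<And>x. f (- x) = - f x"
    and freq: "lacks_frequency 3 f" and ort: "orthonormal_triple e a b" and t: "- 1 \<le> t" "t \<le> 1"
  shows "latitude_integral f e a b t = 2 * pi * t * f e"
proof -
  let ?F = "latitude_integral f e a b"
  have F: "?F (- t) = - ?F t" for t
    unfolding latitude_integral_minus[OF cont] odd by (simp add: latitude_integral_def)
  have pos: "?F t = 2 * pi * t * f e" if t: "0 < t" "t \<le> 1" for t
  proof -
    have "t * ?F t = t ^ 2 * (1 * ?F 1)"
    proof (rule zonal_injective[OF _ _ _ t])
      show "continuous_on UNIV (\<lambda>t. t * ?F t)"
        by (intro continuous_intros continuous_on_latitude_integral[OF cont])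
      show "- t * ?F (- t) = t * ?F t" for t by (simp add: F)
      fix s :: real assume s: "0 \<le> s" "s \<le> 1"
      have cos3: "cos (real 3 * \<theta>) = 4 * cos \<theta> ^ 3 - 3 * cos \<theta>" for \<theta>
        using cos_treble_cos[of \<theta>] by simp
      have eq: "(s * cos \<theta>) * ?F (s * cos \<theta>) * ((real 2 + 2) * (cos \<theta>)\<^sup>2 - (real 2 + 1))
          = s * (?F (s * cos \<theta>) * cos (real 3 * \<theta>))" for \<theta>
        unfolding cos3 by (simp add: algebra_simps power2_eq_square power3_eq_cube)
      then show "integral {0..2*pi} (\<lambda>\<theta>. (s * cos \<theta>) * ?F (s * cos \<theta>) * ((real 2 + 2) * (cos \<theta>)\<^sup>2 - (real 2 + 1))) = 0"
        unfolding eq using lacks_frequency_latitude_integral[OF cont freq ort s] by simp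
    qed
    then show ?thesis using t by (simp add: latitude_integral_pole power2_eq_square)
  qed
  consider "t > 0" | "t = 0" | "t < 0" by linarith
  then show ?thesis
  proof cases
    case 1 then show ?thesis using pos t by simp
  next
    case 2 then show ?thesis using F[of 0] by simp
  next
    case 3
    then have "?F (- t) = 2 * pi * (- t) * f e" using t by (intro pos) auto
    then show ?thesis unfolding F by simp
  qed
qed

section \<open>Even functions without frequency two\<close>

lemma orthonormal_triple_containing:
  fixes e x :: "'a::euclidean_space"
  assumes dim: "DIM('a) \<ge> 3" and e: "norm e = 1"
  obtains a b r where "orthonormal_triple e a b" "r \<ge> 0" "x = (x \<bullet> e) *\<^sub>R e + r *\<^sub>R a"
proof -
  have ee: "e \<bullet> e = 1" using e by (simp add: norm_eq_1)
  define y where "y = x - (x \<bullet> e) *\<^sub>R e"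
  have ye: "y \<bullet> e = 0" by (simp add: y_def inner_simps ee)
  obtain a where a: "norm a = 1" "a \<bullet> e = 0" "y = norm y *\<^sub>R a"
  proof (cases "y = 0")
    case True
    obtain z where "z \<noteq> 0" "orthogonal e z"
      using orthogonal_to_vector_exists[of e] dim by auto
    then show ?thesis using True that[of "z /\<^sub>R norm z"]
      by (simp add: orthogonal_def inner_commute)
  next
    case False
    then show ?thesis using that[of "y /\<^sub>R norm y"] ye by simp
  qed
  have "dim {e, a} \<le> card {e, a}" by (rule dim_le_card') simp
  also have "\<dots> \<le> 2" by (simp add: card_insert_if)
  finally have "dim {e, a} < DIM('a)" using dim by simp
  then obtain z where z: "z \<noteq> 0" "\<And>y. y \<in> span {e, a} \<Longrightarrow> orthogonal z y"
    by (rule orthogonal_to_subspace_exists) blast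
  then have "z \<bullet> e = 0" "z \<bullet> a = 0" by (auto simp: orthogonal_def span_base)
  then have "orthonormal_triple e a (z /\<^sub>R norm z)"
    using e a(1,2) z(1) by (simp add: orthonormal_triple_def inner_commute)
  moreover have "x = (x \<bullet> e) *\<^sub>R e + norm y *\<^sub>R a"
    unfolding a(3)[symmetric] by (simp add: y_def)
  ultimately show thesis by (rule that[OF _ norm_ge_zero])
qed

text \<open>At a maximum point \<open>e\<close> the mean over each circle of latitude equals the maximum, so the function is maximal on all
  these circles. For \<open>0 \<le> t \<le> 1\<close> they sweep out a hemisphere, and evenness reaches the other one.\<close>

lemma even_lacks_frequency_const:
  fixes f :: "'a::euclidean_space \<Rightarrow> real"
  assumes dim: "DIM('a) \<ge> 3"
    and cont: "continuous_on UNIV f" and even: "\<And>x. f (- x) = f x"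
    and freq: "lacks_frequency 2 f"
  shows "\<exists>c. \<forall>x. norm x = 1 \<longrightarrow> f x = c"
proof -
  have ne: "sphere 0 1 \<noteq> ({} :: 'a set)" by simp
  have "continuous_on (sphere 0 1) f" by (rule continuous_on_subset[OF cont]) simp
  from continuous_attains_sup[OF compact_sphere ne this]
  obtain e where "e \<in> sphere 0 1" and *: "\<forall>x\<in>sphere 0 1. f x \<le> f e" by blast
  then have e: "norm e = 1" by simp
  have max: "f x \<le> f e" if "norm x = 1" for x using * that by simp
  have pos: "f x = f e" if x: "norm x = 1" "x \<bullet> e \<ge> 0" for x
  proof -
    obtain a b r where ort: "orthonormal_triple e a b" and r: "r \<ge> 0"
      and xe: "x = (x \<bullet> e) *\<^sub>R e + r *\<^sub>R a"
      by (rule orthonormal_triple_containing[OF dim e])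
    have inn: "e \<bullet> e = 1" "a \<bullet> a = 1" "b \<bullet> b = 1" "e \<bullet> a = 0" "e \<bullet> b = 0" "a \<bullet> b = 0"
      "a \<bullet> e = 0" "b \<bullet> e = 0" "b \<bullet> a = 0"
      using ort by (auto simp: orthonormal_triple_def norm_eq_1 inner_commute)
    define t where "t = x \<bullet> e"
    have xt: "x = t *\<^sub>R e + r *\<^sub>R a" using xe by (simp add: t_def)
    have "x \<bullet> x = t * t + r * r"
      unfolding xt by (simp add: inner_simps inn algebra_simps)
    then have tr: "t\<^sup>2 + r\<^sup>2 = 1" using x by (simp add: norm_eq_1 power2_eq_square)
    have "r\<^sup>2 = 1 - t\<^sup>2" using tr by simp
    then have r_eq: "r = sqrt (1 - t\<^sup>2)" using r by (metis real_sqrt_abs abs_of_nonneg)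
    have "t\<^sup>2 \<le> 1" using tr zero_le_power2[of r] by linarith
    then have t: "0 \<le> t" "t \<le> 1" using x by (auto simp: t_def abs_square_le_1)
    define g where "g \<phi> = f e - f (t *\<^sub>R e + r *\<^sub>R (cos \<phi> *\<^sub>R a + sin \<phi> *\<^sub>R b))" for \<phi>
    have contg: "continuous_on {0..2*pi} g"
      unfolding g_def by (intro continuous_intros continuous_on_compose2[OF cont]) auto
    have gnn: "g \<phi> \<ge> 0" for \<phi>
    proof -
      let ?z = "t *\<^sub>R e + r *\<^sub>R (cos \<phi> *\<^sub>R a + sin \<phi> *\<^sub>R b)"
      have "?z \<bullet> ?z = t * t + r * r * (cos \<phi> * cos \<phi> + sin \<phi> * sin \<phi>)"
        by (simp add: inner_simps inn algebra_simps del: sin_cos_squared_add3)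
      also have "\<dots> = 1" using tr by (simp add: power2_eq_square)
      finally have "norm ?z = 1" by (simp add: norm_eq_1)
      from max[OF this] show ?thesis by (simp add: g_def)
    qed
    have "integral {0..2*pi} g = 2 * pi * f e - latitude_integral f e a b t"
      unfolding g_def latitude_integral_def r_eq[symmetric]
      by (subst integral_diff)
        (auto intro!: integrable_continuous_interval continuous_intros continuous_on_compose2[OF cont])
    also have "\<dots> = 0"
      using latitude_integral_even[OF cont even freq ort t] by simp
    finally have "(g has_integral 0) {0..2*pi}"
      using integrable_continuous_interval[OF contg] by (metis integrable_integral)
    then have "g 0 = 0"
      using has_integral_0_cbox_imp_0[of 0 "2*pi" g 0] contg gnn pi_gt_zero by (simp add: not_le)
    then show ?thesis by (simp add: g_def xt)
  qed
  have "f x = f e" if x: "norm x = 1" for x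
  proof -
    consider "x \<bullet> e \<ge> 0" | "x \<bullet> e < 0" by linarith
    then show ?thesis
    proof cases
      case 1 then show ?thesis using pos x by simp
    next
      case 2 then show ?thesis using pos[of "- x"] x even by simp
    qed
  qed
  then show ?thesis by blast
qed

section \<open>Odd functions without frequency three\<close>

lemma integral_orthogonal_transformation:
  fixes f :: "real^'n::{finite,wellorder} \<Rightarrow> real"
  assumes cont: "continuous_on UNIV f" and supp: "\<And>x. norm x > 1 \<Longrightarrow> f x = 0"
    and R: "orthogonal_transformation R" and B: "cball 0 1 \<subseteq> cbox u v"
  shows "integral (cbox u v) (\<lambda>x. f (R x)) = integral (cbox u v) f"
proof -
  let ?C = "cball 0 1 :: (real^'n::_) set"
  have lin: "linear R" and nrm: "norm (R x) = norm x" for x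
    using R by (auto simp: orthogonal_transformation)
  have box: "integral (cbox u v) h = integral ?C h" if "\<And>x. norm x > 1 \<Longrightarrow> h x = 0" for h :: "real^'n::_ \<Rightarrow> real"
  proof -
    have "integral (cbox u v) h = integral (cbox u v) (\<lambda>x. if x \<in> ?C then h x else 0)"
      using that by (intro integral_cong) auto
    also have "\<dots> = integral ?C h" using B by (simp only: Henstock_Kurzweil_Integration.integral_restrict_Int Int_absorb2)
    finally show ?thesis .
  qed
  define F :: "real^'n::_ \<Rightarrow> real^1" where "F x = vec (f x)" for x
  have F1: "F x $ 1 = f x" for x by (simp add: F_def)
  have "f absolutely_integrable_on cbox u v"
    by (intro absolutely_integrable_continuous continuous_on_subset[OF cont]) simp
  then have "f absolutely_integrable_on ?C"
    by (rule set_integrable_subset) (use B in auto)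
  then have absF: "F absolutely_integrable_on ?C"
    by (simp add: absolutely_integrable_on_1_iff F1)
  have img: "R ` ?C = ?C"
    using image_orthogonal_transformation_cball[OF R, of 0 1] linear_0[OF lin] by simp
  have det: "\<bar>det (matrix R)\<bar> = 1"
    using R orthogonal_transformation_det by blast
  have "integral (R ` ?C) F = \<bar>det (matrix R)\<bar> *\<^sub>R integral ?C (F \<circ> R)"
    by (rule integral_change_of_variables_linear[OF lin]) (simp add: img absF)
  then have "integral ?C F = integral ?C (F \<circ> R)" by (simp add: img det)
  then have "integral ?C f = integral ?C (\<lambda>x. f (R x))"
    by (simp add: integral_on_1_eq F1 vec_eq_iff)
  then show ?thesis
    using box[of f] box[of "\<lambda>x. f (R x)"] supp nrm by simp
qed

lemma orthonormal_triple_expansion: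
  fixes x :: "'a::euclidean_space"
  assumes ort: "orthonormal_triple e a b" and dim: "DIM('a) = 3"
  shows "x = (x \<bullet> e) *\<^sub>R e + (x \<bullet> a) *\<^sub>R a + (x \<bullet> b) *\<^sub>R b"
proof -
  have inn: "e \<bullet> e = 1" "a \<bullet> a = 1" "b \<bullet> b = 1" "e \<bullet> a = 0" "e \<bullet> b = 0" "a \<bullet> b = 0"
    "a \<bullet> e = 0" "b \<bullet> e = 0" "b \<bullet> a = 0"
    using ort by (auto simp: orthonormal_triple_def norm_eq_1 inner_commute)
  have dist: "e \<noteq> a" "e \<noteq> b" "a \<noteq> b" "e \<noteq> 0" "a \<noteq> 0" "b \<noteq> 0" using inn by auto
  have "independent {e, a, b}"
    by (rule pairwise_orthogonal_independent)
      (use dist inn in \<open>auto simp: pairwise_def orthogonal_def\<close>)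
  moreover have "card {e, a, b} = 3" using dist by simp
  ultimately have span: "span {e, a, b} = UNIV"
    using dim card_eq_dim[of "{e, a, b}" UNIV] by auto
  define d where "d = x - ((x \<bullet> e) *\<^sub>R e + (x \<bullet> a) *\<^sub>R a + (x \<bullet> b) *\<^sub>R b)"
  have "orthogonal d y" if "y \<in> {e, a, b}" for y
    using that by (auto simp: d_def orthogonal_def inner_simps inn)
  then have "orthogonal d d"
    using orthogonal_to_span[of d "{e, a, b}" d] span by auto
  then have "d = 0" by (simp add: orthogonal_def)
  then show ?thesis by (simp add: d_def)
qed

text \<open>The integral of \<open>\<omega> x * g x * (x \<bullet> e)\<close> is linear in \<open>e\<close>. Its invariance under the rotations \<open>R \<phi>\<close> about
  \<open>e\<close> allows replacing \<open>g x\<close> by its mean over the orbit of \<open>x\<close>, which is \<open>(x \<bullet> e) * g e\<close>. Hence \<open>g e\<close> is this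
  linear functional divided by the constant \<open>C e\<close>, which is the same for all unit vectors \<open>e\<close>.\<close>

lemma odd_latitude_integral_linear3:
  fixes g :: "real^3 \<Rightarrow> real"
  assumes cont: "continuous_on UNIV g" and hom: "\<And>c x. g (c *\<^sub>R x) = c * g x"
    and lat: "\<And>e a b t. orthonormal_triple e a b \<Longrightarrow> - 1 \<le> t \<Longrightarrow> t \<le> 1 \<Longrightarrow>
       latitude_integral g e a b t = 2 * pi * t * g e"
  shows "\<exists>p. \<forall>x. g x = p \<bullet> x"
proof -
  \<comment> \<open>A continuous radial weight of compact support, so that Fubini on a box applies.\<close>
  define \<omega> :: "real^3 \<Rightarrow> real" where "\<omega> x = max 0 (1 - norm x)" for x
  obtain m :: "real^3" where B: "cball 0 1 \<subseteq> cbox (- m) m"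
    using bounded_subset_cbox_symmetric[OF bounded_cball] by metis
  let ?B = "cbox (- m) m"
  have cont\<omega>: "continuous_on S \<omega>" for S
    unfolding \<omega>_def by (intro continuous_intros)
  have contg: "continuous_on S (\<lambda>x. g (h x))" if "continuous_on S h" for S and h :: "'b::topological_space \<Rightarrow> real^3"
    by (rule continuous_on_compose2[OF cont that]) simp
  define C where "C e = integral ?B (\<lambda>x. \<omega> x * (x \<bullet> e)\<^sup>2)" for e
  have Cconst: "C e = C e'" if ee: "norm e = norm e'" for e e'
  proof -
    obtain R where R: "orthogonal_transformation R" "R e' = e"
      by (rule orthogonal_transformation_exists[of e' e]) (use ee in auto)
    have "norm (R x) = norm x" for x
      using R(1) by (simp add: orthogonal_transformation)
    moreover have "R x \<bullet> e = x \<bullet> e'" for x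
      using R(1) unfolding R(2)[symmetric] by (simp add: orthogonal_transformation_def)
    ultimately have "C e' = integral ?B (\<lambda>x. \<omega> (R x) * (R x \<bullet> e)\<^sup>2)"
      by (simp add: C_def \<omega>_def)
    also have "\<dots> = C e"
      unfolding C_def
      by (rule integral_orthogonal_transformation[OF _ _ R(1) B])
        (auto simp: \<omega>_def intro!: continuous_intros)
    finally show ?thesis by simp
  qed
  have Cpos: "C e \<noteq> 0" if e: "norm e = 1" for e
  proof
    let ?h = "\<lambda>x. \<omega> x * (x \<bullet> e)\<^sup>2"
    assume "C e = 0"
    have conth: "continuous_on ?B ?h" by (intro continuous_intros cont\<omega>)
    have "(?h has_integral 0) ?B"
      using integrable_integral[OF integrable_continuous[OF conth]] \<open>C e = 0\<close> by (simp add: C_def)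
    moreover have "box (- m) m \<noteq> {}"
    proof -
      have "interior (cball 0 1) \<subseteq> interior ?B" using B by (rule interior_mono)
      then have "ball 0 1 \<subseteq> box (- m) m" by simp
      then show ?thesis by auto
    qed
    moreover have "(1/2) *\<^sub>R e \<in> ?B" using B e by (intro subsetD[OF B]) simp
    ultimately have "?h ((1/2) *\<^sub>R e) = 0"
      using has_integral_0_cbox_imp_0[OF conth, of "(1/2) *\<^sub>R e"] by (auto simp: \<omega>_def)
    then show False using e by (auto simp: \<omega>_def norm_eq_1)
  qed
  have main: "integral ?B (\<lambda>x. \<omega> x * g x * (x \<bullet> e)) = g e * C e" if e: "norm e = 1" for e
  proof -
    obtain a b where ort: "orthonormal_triple e a b"
      by (rule orthonormal_triple_containing[OF _ e]) auto
    have inn: "e \<bullet> e = 1" "a \<bullet> a = 1" "b \<bullet> b = 1" "e \<bullet> a = 0" "e \<bullet> b = 0" "a \<bullet> b = 0"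
      "a \<bullet> e = 0" "b \<bullet> e = 0" "b \<bullet> a = 0"
      using ort by (auto simp: orthonormal_triple_def norm_eq_1 inner_commute)
    have expand: "x = (x \<bullet> e) *\<^sub>R e + (x \<bullet> a) *\<^sub>R a + (x \<bullet> b) *\<^sub>R b" for x
      by (rule orthonormal_triple_expansion[OF ort]) simp
    have nsq: "x \<bullet> x = (x \<bullet> e)\<^sup>2 + (x \<bullet> a)\<^sup>2 + (x \<bullet> b)\<^sup>2" for x
      by (subst (1) expand) (simp add: inner_simps power2_eq_square inner_commute)
    define R where "R \<phi> x = (x \<bullet> e) *\<^sub>R e + (cos \<phi> * (x \<bullet> a) - sin \<phi> * (x \<bullet> b)) *\<^sub>R a
        + (sin \<phi> * (x \<bullet> a) + cos \<phi> * (x \<bullet> b)) *\<^sub>R b" for \<phi> x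
    have Re: "R \<phi> x \<bullet> e = x \<bullet> e" "R \<phi> x \<bullet> a = cos \<phi> * (x \<bullet> a) - sin \<phi> * (x \<bullet> b)"
      "R \<phi> x \<bullet> b = sin \<phi> * (x \<bullet> a) + cos \<phi> * (x \<bullet> b)" for \<phi> x
      by (simp_all add: R_def inner_simps inn)
    have R_norm: "norm (R \<phi> x) = norm x" for \<phi> x
    proof -
      have "R \<phi> x \<bullet> R \<phi> x = (x \<bullet> e)\<^sup>2 + (cos \<phi> * cos \<phi> + sin \<phi> * sin \<phi>) * ((x \<bullet> a)\<^sup>2 + (x \<bullet> b)\<^sup>2)"
        unfolding nsq[of "R \<phi> x"] Re by (simp add: power2_eq_square algebra_simps del: sin_cos_squared_add3)
      also have "\<dots> = x \<bullet> x" unfolding nsq[of x] by simp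
      finally show ?thesis by (simp add: norm_eq_sqrt_inner)
    qed
    have R_orth: "orthogonal_transformation (R \<phi>)" for \<phi>
      unfolding orthogonal_transformation
      by (auto simp: R_norm) (auto intro!: linearI simp: R_def inner_simps algebra_simps)
    have avg: "integral {0..2*pi} (\<lambda>\<phi>. g (R \<phi> x)) = 2 * pi * (x \<bullet> e) * g e" for x
    proof (cases "x = 0")
      case True
      then show ?thesis using hom[of 0 0] by (simp add: R_def)
    next
      case False
      define n where "n = norm x"
      define t where "t = (x \<bullet> e) / n"
      have n: "n > 0" using False by (simp add: n_def)
      have n2: "n\<^sup>2 = (x \<bullet> e)\<^sup>2 + (x \<bullet> a)\<^sup>2 + (x \<bullet> b)\<^sup>2"
        unfolding n_def power2_norm_eq_inner by (rule nsq)
      then have "((x \<bullet> e)\<^sup>2 + (x \<bullet> a)\<^sup>2 + (x \<bullet> b)\<^sup>2) / n\<^sup>2 = 1"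
        using n by (metis divide_self_if less_irrefl power_not_zero)
      then have "((x \<bullet> a) / n)\<^sup>2 + ((x \<bullet> b) / n)\<^sup>2 = 1 - t\<^sup>2"
        by (simp add: t_def power_divide add_divide_distrib)
      moreover define z where "z = Complex ((x \<bullet> a) / n) ((x \<bullet> b) / n)"
      ultimately have zr: "cmod z = sqrt (1 - t\<^sup>2)" by (simp add: cmod_def)
      then have "z = rcis (sqrt (1 - t\<^sup>2)) (Arg z)" using rcis_cmod_Arg[of z] by simp
      then obtain \<psi> where "z = rcis (sqrt (1 - t\<^sup>2)) \<psi>" by blast
      then have \<psi>: "sqrt (1 - t\<^sup>2) * cos \<psi> = (x \<bullet> a) / n" "sqrt (1 - t\<^sup>2) * sin \<psi> = (x \<bullet> b) / n"
        by (auto simp: complex_eq_iff z_def)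
      have t: "- 1 \<le> t" "t \<le> 1"
        using Cauchy_Schwarz_ineq2[of x e] e n by (auto simp: t_def n_def field_simps abs_le_iff)
      define h where "h \<phi> = g (t *\<^sub>R e + sqrt (1 - t\<^sup>2) *\<^sub>R (cos \<phi> *\<^sub>R a + sin \<phi> *\<^sub>R b))" for \<phi>
      have "continuous_on UNIV h"
        unfolding h_def by (intro contg continuous_intros)
      moreover have "h (\<phi> + 2 * pi) = h \<phi>" for \<phi> by (simp add: h_def)
      ultimately have shift: "integral {0..2*pi} (\<lambda>\<phi>. h (\<phi> + \<psi>)) = integral {0..2*pi} h"
        by (rule integral_periodic_shift)
      have R_h: "g (R \<phi> x) = n * h (\<phi> + \<psi>)" for \<phi>
      proof -
        have *: "sqrt (1 - t\<^sup>2) * cos (\<phi> + \<psi>) = cos \<phi> * ((x \<bullet> a) / n) - sin \<phi> * ((x \<bullet> b) / n)"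
          "sqrt (1 - t\<^sup>2) * sin (\<phi> + \<psi>) = sin \<phi> * ((x \<bullet> a) / n) + cos \<phi> * ((x \<bullet> b) / n)"
          unfolding \<psi>[symmetric] by (simp_all add: cos_add sin_add algebra_simps)
        have "h (\<phi> + \<psi>) = g (t *\<^sub>R e + ((sqrt (1 - t\<^sup>2) * cos (\<phi> + \<psi>)) *\<^sub>R a + (sqrt (1 - t\<^sup>2) * sin (\<phi> + \<psi>)) *\<^sub>R b))"
          by (simp add: h_def scaleR_add_right)
        also have "n * \<dots> = g (n *\<^sub>R (t *\<^sub>R e + ((sqrt (1 - t\<^sup>2) * cos (\<phi> + \<psi>)) *\<^sub>R a + (sqrt (1 - t\<^sup>2) * sin (\<phi> + \<psi>)) *\<^sub>R b)))"
          by (rule hom[symmetric])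
        also have "n *\<^sub>R (t *\<^sub>R e + ((sqrt (1 - t\<^sup>2) * cos (\<phi> + \<psi>)) *\<^sub>R a + (sqrt (1 - t\<^sup>2) * sin (\<phi> + \<psi>)) *\<^sub>R b)) = R \<phi> x"
          unfolding * R_def using n by (simp add: t_def scaleR_add_right right_diff_distrib distrib_left)
        finally show ?thesis by simp
      qed
      have "integral {0..2*pi} (\<lambda>\<phi>. g (R \<phi> x)) = n * latitude_integral g e a b t"
        unfolding R_h using shift by (simp add: latitude_integral_def h_def[abs_def])
      also have "\<dots> = 2 * pi * (x \<bullet> e) * g e"
        using lat[OF ort t] n by (simp add: t_def)
      finally show ?thesis .
    qed
    define I where "I = integral ?B (\<lambda>x. \<omega> x * g x * (x \<bullet> e))"
    have inv: "integral ?B (\<lambda>x. \<omega> x * (x \<bullet> e) * g (R \<phi> x)) = I" for \<phi>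
    proof -
      have "integral ?B (\<lambda>x. \<omega> (R \<phi> x) * g (R \<phi> x) * (R \<phi> x \<bullet> e)) = I"
        unfolding I_def
        by (rule integral_orthogonal_transformation[OF _ _ R_orth B])
          (auto simp: \<omega>_def intro!: continuous_intros cont)
      then show ?thesis by (simp add: \<omega>_def R_norm Re mult_ac)
    qed
    have contR: "continuous_on (cbox (0, - m) (2*pi, m)) (\<lambda>(\<phi>, x). \<omega> x * (x \<bullet> e) * g (R \<phi> x))"
      unfolding split_def R_def \<omega>_def
      by (intro continuous_intros contg)
    have fibre: "integral {0..2*pi} (\<lambda>\<phi>. \<omega> x * (x \<bullet> e) * g (R \<phi> x)) = (2 * pi * g e) * (\<omega> x * (x \<bullet> e)\<^sup>2)" for x
      unfolding integral_mult_right avg by (simp add: power2_eq_square)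
    have "2 * pi * I = integral {0..2*pi} (\<lambda>\<phi>. integral ?B (\<lambda>x. \<omega> x * (x \<bullet> e) * g (R \<phi> x)))"
      unfolding inv by simp
    also have "\<dots> = integral ?B (\<lambda>x. integral {0..2*pi} (\<lambda>\<phi>. \<omega> x * (x \<bullet> e) * g (R \<phi> x)))"
      using integral_swap_continuous[OF contR] by simp
    also have "\<dots> = integral ?B (\<lambda>x. (2 * pi * g e) * (\<omega> x * (x \<bullet> e)\<^sup>2))"
      unfolding fibre ..
    also have "\<dots> = 2 * pi * g e * C e" by (simp add: C_def)
    finally show ?thesis by (simp add: I_def)
  qed
  define V where "V = integral ?B (\<lambda>x. (\<omega> x * g x) *\<^sub>R x)"
  define c where "c = C (axis 1 1)"
  have unit: "g e = ((1/c) *\<^sub>R V) \<bullet> e" if e: "norm e = 1" for e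
  proof -
    have "(\<lambda>x. (\<omega> x * g x) *\<^sub>R x) integrable_on ?B"
      by (intro integrable_continuous continuous_intros cont\<omega> contg)
    from integral_linear[OF this bounded_linear_inner_left[of e]]
    have "integral ?B (\<lambda>x. \<omega> x * g x * (x \<bullet> e)) = V \<bullet> e"
      by (simp add: o_def V_def)
    moreover have "C e = c" unfolding c_def by (rule Cconst) (simp add: e norm_axis_1)
    ultimately show ?thesis using main[OF e] Cpos[OF e] by (simp add: field_simps)
  qed
  have "g x = ((1/c) *\<^sub>R V) \<bullet> x" for x
  proof (cases "x = 0")
    case True
    then show ?thesis using hom[of 0 0] by simp
  next
    case False
    then have "g ((1 / norm x) *\<^sub>R x) = ((1/c) *\<^sub>R V) \<bullet> ((1 / norm x) *\<^sub>R x)"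
      by (intro unit) simp
    then show ?thesis using False unfolding hom by (simp add: field_simps)
  qed
  then show ?thesis by blast
qed

text \<open>Additivity concerns only two vectors at a time, and these lie in an isometric copy of \<open>\<real>\<^sup>3\<close>.\<close>

lemma odd_lacks_frequency_linear:
  fixes f :: "'a::euclidean_space \<Rightarrow> real"
  assumes dim: "DIM('a) \<ge> 3"
    and cont: "continuous_on UNIV f" and hom: "\<And>c x. f (c *\<^sub>R x) = c * f x"
    and freq: "lacks_frequency 3 f"
  shows "\<exists>p. \<forall>x. f x = p \<bullet> x"
proof -
  have odd: "f (- x) = - f x" for x using hom[of "- 1" x] by simp
  have add: "f (x + y) = f x + f y" for x y
  proof -
    have "\<exists>e::'a. norm e = 1 \<and> x = norm x *\<^sub>R e"
    proof (cases "x = 0")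
      case True
      then show ?thesis using vector_choose_size[of 1] by auto
    next
      case False
      then show ?thesis by (intro exI[of _ "x /\<^sub>R norm x"]) simp
    qed
    then obtain e where e: "norm e = 1" "x = norm x *\<^sub>R e" by blast
    obtain a b r where ort: "orthonormal_triple e a b" and y: "y = (y \<bullet> e) *\<^sub>R e + r *\<^sub>R a"
      by (rule orthonormal_triple_containing[OF dim e(1), of y])
    have inn: "e \<bullet> e = 1" "a \<bullet> a = 1" "b \<bullet> b = 1" "e \<bullet> a = 0" "e \<bullet> b = 0" "a \<bullet> b = 0"
      "a \<bullet> e = 0" "b \<bullet> e = 0" "b \<bullet> a = 0"
      using ort by (auto simp: orthonormal_triple_def norm_eq_1 inner_commute)
    define \<iota> :: "real^3 \<Rightarrow> 'a" where "\<iota> z = (z $ 1) *\<^sub>R e + (z $ 2) *\<^sub>R a + (z $ 3) *\<^sub>R b" for z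
    have \<iota>_inner: "\<iota> z \<bullet> \<iota> z' = z \<bullet> z'" for z z'
      by (simp add: \<iota>_def inner_simps inn inner_vec_def sum_3)
    have \<iota>_add: "\<iota> (z + z') = \<iota> z + \<iota> z'" for z z' by (simp add: \<iota>_def algebra_simps)
    have \<iota>_scale: "\<iota> (c *\<^sub>R z) = c *\<^sub>R \<iota> z" for c z by (simp add: \<iota>_def algebra_simps)
    have "\<exists>p. \<forall>z. f (\<iota> z) = p \<bullet> z"
    proof (rule odd_latitude_integral_linear3)
      show "continuous_on UNIV (\<lambda>z. f (\<iota> z))"
        unfolding \<iota>_def by (intro continuous_on_compose2[OF cont] continuous_intros) auto
      show "f (\<iota> (c *\<^sub>R z)) = c * f (\<iota> z)" for c z by (simp add: \<iota>_scale hom)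
      fix e' a' b' :: "real^3" and t :: real
      assume "orthonormal_triple e' a' b'" and t: "- 1 \<le> t" "t \<le> 1"
      then have "orthonormal_triple (\<iota> e') (\<iota> a') (\<iota> b')"
        by (simp add: orthonormal_triple_def norm_eq_sqrt_inner \<iota>_inner)
      from latitude_integral_odd[OF cont odd freq this t]
      show "latitude_integral (\<lambda>z. f (\<iota> z)) e' a' b' t = 2 * pi * t * f (\<iota> e')"
        by (simp add: latitude_integral_def \<iota>_add \<iota>_scale)
    qed
    then obtain p where p: "\<And>z. f (\<iota> z) = p \<bullet> z" by blast
    define x' y' :: "real^3" where "x' = vector [norm x, 0, 0]" and "y' = vector [y \<bullet> e, r, 0]"
    have "\<iota> x' = x" using e(2) by (simp add: \<iota>_def x'_def)
    moreover have "\<iota> y' = y" using y by (simp add: \<iota>_def y'_def)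
    ultimately show ?thesis
      using p[of "x' + y'"] p[of x'] p[of y'] by (simp add: \<iota>_add inner_add_right)
  qed
  have "linear f" by (intro linearI add) (simp add: hom)
  then have "f x = adjoint f 1 \<bullet> x" for x
    using adjoint_works[of f x 1] by (simp add: inner_commute)
  then show ?thesis by blast
qed

section \<open>Support functions and projections\<close>

lemma convex_body_compact_nonempty:
  assumes "convex_body K"
  shows "compact K" "convex K" "K \<noteq> {}"
  using assms interior_subset[of K] by (auto simp: convex_body_def)

lemma support_function_attained:
  fixes K :: "'a::euclidean_space set"
  assumes "compact K" "K \<noteq> {}"
  obtains x where "x \<in> K" "support_function K u = x \<bullet> u"
proof -
  have "continuous_on K (\<lambda>x. x \<bullet> u)" by (intro continuous_intros)
  from continuous_attains_sup[OF assms this] obtain x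
    where "x \<in> K" "\<And>y. y \<in> K \<Longrightarrow> y \<bullet> u \<le> x \<bullet> u" by blast
  then show thesis
    by (intro that[of x]) (auto simp: support_function_def intro!: cSup_eq_maximum)
qed

lemma inner_le_support_function:
  fixes K :: "'a::euclidean_space set"
  assumes "compact K" "x \<in> K"
  shows "x \<bullet> u \<le> support_function K u"
proof -
  have "compact ((\<lambda>x. x \<bullet> u) ` K)"
    by (intro compact_continuous_image continuous_intros assms)
  then have "bdd_above ((\<lambda>x. x \<bullet> u) ` K)"
    by (intro bounded_imp_bdd_above compact_imp_bounded)
  then show ?thesis unfolding support_function_def using assms(2) by (rule cSUP_upper[rotated])
qed

lemma support_function_scaleR:
  fixes K :: "'a::euclidean_space set"
  assumes K: "compact K" "K \<noteq> {}" and c: "c \<ge> 0"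
  shows "support_function K (c *\<^sub>R u) = c * support_function K u"
proof (rule antisym)
  obtain x where "x \<in> K" "support_function K (c *\<^sub>R u) = x \<bullet> (c *\<^sub>R u)"
    by (rule support_function_attained[OF K])
  then show "support_function K (c *\<^sub>R u) \<le> c * support_function K u"
    using inner_le_support_function[OF K(1), of x u] c by (simp add: mult_left_mono)
  obtain x where "x \<in> K" "support_function K u = x \<bullet> u"
    by (rule support_function_attained[OF K])
  then show "c * support_function K u \<le> support_function K (c *\<^sub>R u)"
    using inner_le_support_function[OF K(1), of x "c *\<^sub>R u"] by simp
qed

lemma continuous_on_support_function:
  fixes K :: "'a::euclidean_space set"
  assumes K: "compact K" "K \<noteq> {}"
  shows "continuous_on UNIV (support_function K)"
proof -
  obtain B where B: "\<And>x. x \<in> K \<Longrightarrow> norm x \<le> B"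
    using compact_imp_bounded[OF K(1)] by (auto simp: bounded_iff)
  have B0: "B \<ge> 0" using K(2) B norm_ge_zero order_trans by blast
  have le: "support_function K u \<le> support_function K v + B * norm (u - v)" for u v
  proof -
    obtain x where x: "x \<in> K" "support_function K u = x \<bullet> u"
      by (rule support_function_attained[OF K])
    have "x \<bullet> u = x \<bullet> v + x \<bullet> (u - v)" by (simp add: inner_simps)
    also have "x \<bullet> v \<le> support_function K v" by (rule inner_le_support_function[OF K(1) x(1)])
    also have "x \<bullet> (u - v) \<le> norm x * norm (u - v)" by (rule norm_cauchy_schwarz)
    also have "\<dots> \<le> B * norm (u - v)" using B[OF x(1)] by (intro mult_right_mono) auto
    finally show ?thesis using x(2) by simp
  qed
  have "\<bar>support_function K u - support_function K v\<bar> \<le> B * norm (u - v)" for u v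
    using le[of u v] le[of v u] by (simp add: norm_minus_commute abs_le_iff)
  then have "B-lipschitz_on UNIV (support_function K)"
    using B0 by (intro lipschitz_onI) (auto simp: dist_norm)
  then show ?thesis by (rule lipschitz_on_continuous_on)
qed

lemma mem_iff_support_function:
  fixes K :: "'a::euclidean_space set"
  assumes K: "compact K" "convex K" "K \<noteq> {}"
  shows "x \<in> K \<longleftrightarrow> (\<forall>u. x \<bullet> u \<le> support_function K u)"
proof
  assume "x \<in> K"
  then show "\<forall>u. x \<bullet> u \<le> support_function K u" using inner_le_support_function[OF K(1)] by blast
next
  assume *: "\<forall>u. x \<bullet> u \<le> support_function K u"
  show "x \<in> K"
  proof (rule ccontr)
    assume "x \<notin> K"
    then obtain a b where ab: "a \<bullet> x < b" "\<forall>y\<in>K. a \<bullet> y > b"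
      using separating_hyperplane_closed_point[OF K(2) compact_imp_closed[OF K(1)]] by blast
    obtain y where "y \<in> K" "support_function K (- a) = y \<bullet> - a"
      by (rule support_function_attained[OF K(1,3)])
    then have "x \<bullet> - a \<le> y \<bullet> - a" using * by metis
    then show False using ab \<open>y \<in> K\<close> by (force simp: inner_commute)
  qed
qed

lemma plane_orthonormal_coordinates:
  fixes u v x :: "'a::euclidean_space"
  assumes "norm u = 1" "norm v = 1" "u \<bullet> v = 0" and x: "x \<in> span {u, v}"
  shows "x = (x \<bullet> u) *\<^sub>R u + (x \<bullet> v) *\<^sub>R v"
proof -
  have inn: "u \<bullet> u = 1" "v \<bullet> v = 1" "u \<bullet> v = 0" "v \<bullet> u = 0"
    using assms by (auto simp: norm_eq_1 inner_commute)
  obtain a b where "x = a *\<^sub>R u + b *\<^sub>R v"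
    using x by (auto simp: span_insert span_singleton algebra_simps) 
  then show ?thesis by (simp add: inner_simps inn)
qed

lemma proj_onto_plane:
  fixes K :: "'a::euclidean_space set"
  assumes P: "subspace P"
  shows "x \<in> K \<Longrightarrow> \<exists>y\<in>proj_onto K P. \<forall>w\<in>P. y \<bullet> w = x \<bullet> w"
    and "y \<in> proj_onto K P \<Longrightarrow> \<exists>x\<in>K. \<forall>w\<in>P. y \<bullet> w = x \<bullet> w"
proof -
  assume x: "x \<in> K"
  obtain y z where "y \<in> span P" "\<And>w. w \<in> span P \<Longrightarrow> orthogonal z w" "x = y + z"
    using orthogonal_subspace_decomp_exists[of P x] by metis
  moreover have "span P = P" using P by (simp add: span_eq_iff)
  ultimately have y: "y \<in> P" "x - y = z" "\<And>w. w \<in> P \<Longrightarrow> orthogonal z w" by auto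
  then have "y \<in> proj_onto K P"
    using x by (auto simp: proj_onto_def orthogonal_comp_def orthogonal_commute)
  moreover have "y \<bullet> w = x \<bullet> w" if "w \<in> P" for w
    using y(3)[OF that] y(2) by (auto simp: orthogonal_def inner_simps)
  ultimately show "\<exists>y\<in>proj_onto K P. \<forall>w\<in>P. y \<bullet> w = x \<bullet> w" by blast
next
  assume "y \<in> proj_onto K P"
  then obtain x where x: "x \<in> K" "x - y \<in> P\<^sup>\<bottom>" by (auto simp: proj_onto_def)
  then have "y \<bullet> w = x \<bullet> w" if "w \<in> P" for w
    using that by (auto simp: orthogonal_comp_def orthogonal_def inner_simps inner_commute)
  then show "\<exists>x\<in>K. \<forall>w\<in>P. y \<bullet> w = x \<bullet> w" using x by blast
qed

text \<open>The fibre of the projection over \<open>y\<close> is the affine subspace \<open>y + P\<^sup>\<bottom>\<close>. If it misses \<open>K\<close>, a separating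
  functional is bounded on the fibre, so it is orthogonal to \<open>P\<^sup>\<bottom>\<close> and is given by a vector of \<open>P\<close>.\<close>

lemma mem_proj_onto_iff:
  fixes K :: "'a::euclidean_space set"
  assumes K: "compact K" "convex K" "K \<noteq> {}" and P: "subspace P" and y: "y \<in> P"
  shows "y \<in> proj_onto K P \<longleftrightarrow> (\<forall>w\<in>P. y \<bullet> w \<le> support_function K w)"
proof
  assume "y \<in> proj_onto K P"
  then show "\<forall>w\<in>P. y \<bullet> w \<le> support_function K w"
    using proj_onto_plane(2)[OF P] inner_le_support_function[OF K(1)] by metis
next
  assume le: "\<forall>w\<in>P. y \<bullet> w \<le> support_function K w"
  let ?A = "{y + z | z. z \<in> P\<^sup>\<bottom>}"
  show "y \<in> proj_onto K P"
  proof (rule ccontr)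
    assume "y \<notin> proj_onto K P"
    have A: "?A = (+) y ` (P\<^sup>\<bottom>)" by blast
    have "K \<inter> ?A = {}"
      using \<open>y \<notin> proj_onto K P\<close> y by (auto simp: proj_onto_def)
    moreover have "convex ?A"
      unfolding A by (intro convex_translation subspace_imp_convex subspace_orthogonal_comp)
    moreover have "closed ?A"
      unfolding A by (intro closed_translation closed_subspace subspace_orthogonal_comp)
    moreover have "?A \<noteq> {}"
      using subspace_0[OF subspace_orthogonal_comp[of P]] by blast
    ultimately have "\<exists>a b. (\<forall>x\<in>?A. inner a x < b) \<and> (\<forall>x\<in>K. inner a x > b)"
      using K by (intro separating_hyperplane_closed_compact) (auto simp: inf_commute)
    then obtain a b where ab: "\<And>x. x \<in> ?A \<Longrightarrow> a \<bullet> x < b" "\<And>x. x \<in> K \<Longrightarrow> a \<bullet> x > b"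
      by blast
    \<comment> \<open>Otherwise the fibre contains a point where the functional takes the value \<open>b\<close>.\<close>
    have a_perp: "a \<bullet> z = 0" if z: "z \<in> P\<^sup>\<bottom>" for z
    proof (rule ccontr)
      assume nz: "a \<bullet> z \<noteq> 0"
      have "((b - a \<bullet> y) / (a \<bullet> z)) *\<^sub>R z \<in> P\<^sup>\<bottom>"
        using subspace_orthogonal_comp z by (rule subspace_scale)
      then have "a \<bullet> (y + ((b - a \<bullet> y) / (a \<bullet> z)) *\<^sub>R z) < b" by (intro ab) auto
      then show False using nz by (simp add: inner_simps)
    qed
    then have "a \<in> P\<^sup>\<bottom>\<^sup>\<bottom>" by (auto simp: orthogonal_comp_def orthogonal_def inner_commute)
    then have "- a \<in> P" using orthogonal_comp_self[OF P] P by (simp add: subspace_neg)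
    obtain x where x: "x \<in> K" "support_function K (- a) = x \<bullet> - a"
      by (rule support_function_attained[OF K(1,3)])
    have "y \<bullet> - a \<le> x \<bullet> - a" using le \<open>- a \<in> P\<close> x by metis
    moreover have "a \<bullet> y < b" using ab(1)[of y] subspace_0[OF subspace_orthogonal_comp[of P]] by force
    ultimately show False using ab(2)[OF x(1)] by (simp add: inner_commute)
  qed
qed

section \<open>Bodies with symmetric projections\<close>

text \<open>A change to another orthonormal basis of the plane is a rotation or a reflection, according to the
  sign \<open>\<sigma>\<close> of its determinant, so a rotation keeps its matrix up to the sign of the angle.\<close>

lemma rotation_of_plane_in_basis:
  fixes u v :: "'a::euclidean_space"
  assumes rot: "rotation_of_plane P \<theta> \<phi>"
    and uv: "norm u = 1" "norm v = 1" "u \<bullet> v = 0" "span {u, v} = P"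
  shows "\<exists>\<theta>'\<in>{\<theta>, - \<theta>}. \<forall>a b. \<phi> (a *\<^sub>R u + b *\<^sub>R v) =
           (a * cos \<theta>' - b * sin \<theta>') *\<^sub>R u + (a * sin \<theta>' + b * cos \<theta>') *\<^sub>R v"
proof -
  obtain u0 v0 where u0v0: "norm u0 = 1" "norm v0 = 1" "u0 \<bullet> v0 = 0" "span {u0, v0} = P"
    and \<phi>: "\<And>a b. \<phi> (a *\<^sub>R u0 + b *\<^sub>R v0) =
           (a * cos \<theta> - b * sin \<theta>) *\<^sub>R u0 + (a * sin \<theta> + b * cos \<theta>) *\<^sub>R v0"
    using rot by (auto simp: rotation_of_plane_def orthogonal_def)
  have inn: "u0 \<bullet> u0 = 1" "v0 \<bullet> v0 = 1" "u0 \<bullet> v0 = 0" "v0 \<bullet> u0 = 0"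
    using u0v0 by (auto simp: norm_eq_1 inner_commute)
  define p r p' r' where pr: "p = u \<bullet> u0" "r = u \<bullet> v0" "p' = v \<bullet> u0" "r' = v \<bullet> v0"
  have "u \<in> P" "v \<in> P" using uv(4) by (auto intro: span_base)
  then have u: "u = p *\<^sub>R u0 + r *\<^sub>R v0" and v: "v = p' *\<^sub>R u0 + r' *\<^sub>R v0"
    using plane_orthonormal_coordinates[OF u0v0(1-3)] u0v0(4) by (auto simp: pr)
  have "u \<bullet> u = p * p + r * r" by (simp add: u inner_simps inn)
  then have 1: "p * p + r * r = 1" using uv by (simp add: norm_eq_1)
  have "v \<bullet> v = p' * p' + r' * r'" by (simp add: v inner_simps inn)
  then have 2: "p' * p' + r' * r' = 1" using uv by (simp add: norm_eq_1)
  have "u \<bullet> v = p * p' + r * r'" by (simp add: u v inner_simps inn)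
  then have 3: "p * p' + r * r' = 0" using uv by simp
  \<comment> \<open>The determinant of the change of basis.\<close>
  define \<sigma> where "\<sigma> = p * r' - r * p'"
  have "\<sigma> * \<sigma> = (p * p + r * r) * (p' * p' + r' * r') - (p * p' + r * r') * (p * p' + r * r')"
    by (simp add: \<sigma>_def algebra_simps)
  then have "\<sigma> * \<sigma> = 1" by (simp add: 1 2 3)
  then have \<sigma>: "\<sigma> = 1 \<or> \<sigma> = - 1" by (simp add: square_eq_1_iff)
  have "- \<sigma> * r = (p * p + r * r) * p' - p * (p * p' + r * r')"
    by (simp add: \<sigma>_def algebra_simps)
  then have p': "p' = - \<sigma> * r" by (simp add: 1 3)
  have "\<sigma> * p = (p * p + r * r) * r' - r * (p * p' + r * r')"
    by (simp add: \<sigma>_def algebra_simps)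
  then have r': "r' = \<sigma> * p" by (simp add: 1 3)
  define \<theta>' where "\<theta>' = \<sigma> * \<theta>"
  have \<theta>': "\<theta>' \<in> {\<theta>, - \<theta>}" "cos \<theta>' = cos \<theta>" "sin \<theta>' = \<sigma> * sin \<theta>"
    using \<sigma> by (auto simp: \<theta>'_def)
  have "\<phi> (a *\<^sub>R u + b *\<^sub>R v) =
           (a * cos \<theta>' - b * sin \<theta>') *\<^sub>R u + (a * sin \<theta>' + b * cos \<theta>') *\<^sub>R v" for a b
  proof -
    have "a *\<^sub>R u + b *\<^sub>R v = (a * p + b * p') *\<^sub>R u0 + (a * r + b * r') *\<^sub>R v0"
      by (simp add: u v algebra_simps)
    then have "\<phi> (a *\<^sub>R u + b *\<^sub>R v)
        = ((a * p + b * p') * cos \<theta> - (a * r + b * r') * sin \<theta>) *\<^sub>R u0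
          + ((a * p + b * p') * sin \<theta> + (a * r + b * r') * cos \<theta>) *\<^sub>R v0"
      by (simp only: \<phi>)
    also have "(a * p + b * p') * cos \<theta> - (a * r + b * r') * sin \<theta>
        = (a * cos \<theta>' - b * sin \<theta>') * p + (a * sin \<theta>' + b * cos \<theta>') * p'"
      unfolding \<theta>'(2,3) p' r' using \<open>\<sigma> * \<sigma> = 1\<close> \<sigma> by (auto simp: algebra_simps)
    also have "(a * p + b * p') * sin \<theta> + (a * r + b * r') * cos \<theta>
        = (a * cos \<theta>' - b * sin \<theta>') * r + (a * sin \<theta>' + b * cos \<theta>') * r'"
      unfolding \<theta>'(2,3) p' r' using \<open>\<sigma> * \<sigma> = 1\<close> \<sigma> by (auto simp: algebra_simps)
    finally show ?thesis by (simp add: u v algebra_simps)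
  qed
  then show ?thesis using \<theta>'(1) by blast
qed

lemma support_function_rotation:
  fixes K :: "'a::euclidean_space set"
  assumes K: "compact K" "K \<noteq> {}" and P: "subspace P"
    and img: "(\<lambda>x. \<phi> x + b) ` proj_onto K P = proj_onto K P"
    and w: "w \<in> P" "w' \<in> P" and adj: "\<And>y. y \<in> P \<Longrightarrow> \<phi> y \<bullet> w = y \<bullet> w'"
  shows "support_function K w = support_function K w' + b \<bullet> w"
proof (rule antisym)
  let ?S = "proj_onto K P"
  have SP: "?S \<subseteq> P" by (auto simp: proj_onto_def)
  have le: "y \<bullet> w \<le> support_function K w" if "y \<in> ?S" "w \<in> P" for y w
    using proj_onto_plane(2)[OF P that(1)] that(2) inner_le_support_function[OF K(1)] by metis
  have att: "\<exists>y\<in>?S. support_function K w = y \<bullet> w" if "w \<in> P" for w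
  proof -
    obtain x where "x \<in> K" "support_function K w = x \<bullet> w" by (rule support_function_attained[OF K])
    then show ?thesis using proj_onto_plane(1)[OF P] that by metis
  qed
  obtain s where s: "s \<in> ?S" "support_function K w = s \<bullet> w" using att[OF w(1)] by blast
  then obtain y where y: "y \<in> ?S" "s = \<phi> y + b" using img by blast
  have "s \<bullet> w = y \<bullet> w' + b \<bullet> w" using adj[of y] y SP by (auto simp: inner_add_left)
  then show "support_function K w \<le> support_function K w' + b \<bullet> w"
    using le[OF y(1) w(2)] s(2) by simp
  obtain y where y: "y \<in> ?S" "support_function K w' = y \<bullet> w'" using att[OF w(2)] by blast
  then have "\<phi> y + b \<in> ?S" using img by blast
  from le[OF this w(1)] show "support_function K w' + b \<bullet> w \<le> support_function K w"
    using adj[of y] y SP by (auto simp: inner_add_left)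
qed

lemma rotationally_symmetric_support_function:
  fixes K :: "'a::euclidean_space set"
  assumes K: "compact K" "K \<noteq> {}"
    and uv: "norm u = 1" "norm v = 1" "u \<bullet> v = 0"
    and sym: "rotationally_symmetric q (span {u, v}) (proj_onto K (span {u, v}))"
  shows "\<exists>\<theta>\<in>{2 * pi / real q, - (2 * pi / real q)}. \<exists>b. \<forall>x.
           support_function K (cos x *\<^sub>R u + sin x *\<^sub>R v)
           = support_function K (cos (x - \<theta>) *\<^sub>R u + sin (x - \<theta>) *\<^sub>R v) + b \<bullet> (cos x *\<^sub>R u + sin x *\<^sub>R v)"
proof -
  let ?P = "span {u, v}"
  have inn: "u \<bullet> u = 1" "v \<bullet> v = 1" "u \<bullet> v = 0" "v \<bullet> u = 0"
    using uv by (auto simp: norm_eq_1 inner_commute)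
  have inP: "\<alpha> *\<^sub>R u + \<beta> *\<^sub>R v \<in> ?P" for \<alpha> \<beta>
    by (intro span_add span_scale span_base) auto
  obtain \<phi> b where rot: "rotation_of_plane ?P (2 * pi / real q) \<phi>"
    and img: "(\<lambda>x. \<phi> x + b) ` proj_onto K ?P = proj_onto K ?P"
    using sym by (auto simp: rotationally_symmetric_def)
  obtain \<theta> where \<theta>: "\<theta> \<in> {2 * pi / real q, - (2 * pi / real q)}"
    and \<phi>: "\<And>\<alpha> \<beta>. \<phi> (\<alpha> *\<^sub>R u + \<beta> *\<^sub>R v) =
           (\<alpha> * cos \<theta> - \<beta> * sin \<theta>) *\<^sub>R u + (\<alpha> * sin \<theta> + \<beta> * cos \<theta>) *\<^sub>R v"
    using rotation_of_plane_in_basis[OF rot uv refl] by blast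
  have "support_function K (cos x *\<^sub>R u + sin x *\<^sub>R v)
      = support_function K (cos (x - \<theta>) *\<^sub>R u + sin (x - \<theta>) *\<^sub>R v) + b \<bullet> (cos x *\<^sub>R u + sin x *\<^sub>R v)" for x
  proof (rule support_function_rotation[OF K subspace_span img inP inP])
    fix y assume "y \<in> ?P"
    then have y: "y = (y \<bullet> u) *\<^sub>R u + (y \<bullet> v) *\<^sub>R v"
      by (rule plane_orthonormal_coordinates[OF uv])
    define \<alpha> \<beta> where "\<alpha> = y \<bullet> u" "\<beta> = y \<bullet> v"
    have y': "y = \<alpha> *\<^sub>R u + \<beta> *\<^sub>R v" using y by (simp add: \<alpha>_\<beta>_def)
    show "\<phi> y \<bullet> (cos x *\<^sub>R u + sin x *\<^sub>R v) = y \<bullet> (cos (x - \<theta>) *\<^sub>R u + sin (x - \<theta>) *\<^sub>R v)"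
      unfolding y' \<phi> by (simp add: inner_simps inn cos_diff sin_diff algebra_simps)
  qed
  then show ?thesis using \<theta> by blast
qed

text \<open>If \<open>k < q\<close> then \<open>k\<close> is not a multiple of \<open>q\<close>, whence \<open>cis (2 * \<pi> * k / q) \<noteq> 1\<close>.\<close>

lemma symmetric_projections_lack_frequency:
  fixes K :: "'a::euclidean_space set" and k :: nat
  assumes K: "compact K" "K \<noteq> {}" and k: "k \<ge> 2"
    and sym: "\<And>P. subspace P \<Longrightarrow> dim P = 2 \<Longrightarrow> \<exists>q>k. rotationally_symmetric q P (proj_onto K P)"
  shows "lacks_frequency k (support_function K)"
  unfolding lacks_frequency_def
proof (intro allI impI)
  fix u v :: 'a assume "norm u = 1 \<and> norm v = 1 \<and> u \<bullet> v = 0"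
  then have uv: "norm u = 1" "norm v = 1" "u \<bullet> v = 0" by auto
  have inn: "u \<bullet> u = 1" "v \<bullet> v = 1" "u \<bullet> v = 0" "v \<bullet> u = 0"
    using uv by (auto simp: norm_eq_1 inner_commute)
  have "independent {u, v}"
    by (rule pairwise_orthogonal_independent)
      (use uv in \<open>auto simp: pairwise_def orthogonal_def inner_commute\<close>)
  moreover have "u \<noteq> v" using inn by auto
  ultimately have "dim (span {u, v}) = 2" by (simp add: dim_eq_card_independent)
  then obtain q where q: "q > k" "rotationally_symmetric q (span {u, v}) (proj_onto K (span {u, v}))"
    using sym[OF subspace_span] by blast
  obtain \<theta> b where \<theta>: "\<theta> \<in> {2 * pi / real q, - (2 * pi / real q)}"
    and rel: "\<And>x. support_function K (cos x *\<^sub>R u + sin x *\<^sub>R v)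
       = support_function K (cos (x - \<theta>) *\<^sub>R u + sin (x - \<theta>) *\<^sub>R v) + b \<bullet> (cos x *\<^sub>R u + sin x *\<^sub>R v)"
    using rotationally_symmetric_support_function[OF K uv q(2)] by blast
  define p where "p x = support_function K (cos x *\<^sub>R u + sin x *\<^sub>R v)" for x
  have cis: "cis (real k * \<theta>) \<noteq> 1"
  proof
    assume "cis (real k * \<theta>) = 1"
    then have "Re (cis (real k * \<theta>)) = Re 1" by (simp only:)
    then have "cos (real k * \<theta>) = 1" by simp
    then have "cos (real k * (2 * pi / real q)) = 1" using \<theta> by auto
    then obtain n :: int where "real k * (2 * pi / real q) = of_int n * 2 * pi"
      by (auto simp: cos_one_2pi_int)
    then have "(2 * pi) * (real k / real q) = (2 * pi) * of_int n" by (simp add: mult_ac)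
    then have "real k / real q = of_int n" by (simp only: mult_cancel_left) simp
    moreover have "0 < real k / real q" "real k / real q < 1" using q(1) k by auto
    ultimately show False by simp
  qed
  have shift: "p x = p (x - \<theta>) + (b \<bullet> u) * cos x + (b \<bullet> v) * sin x" for x
    unfolding p_def by (subst rel) (simp add: inner_simps)
  have cont: "continuous_on UNIV p"
    unfolding p_def
    by (intro continuous_on_compose2[OF continuous_on_support_function[OF K]] continuous_intros) auto
  have "p (x + 2 * pi) = p x" for x by (simp add: p_def)
  from fourier_coefficient_eq_0[OF cont this shift k cis]
  have "integral {0..2*pi} (\<lambda>x. p x * cos (real k * x)) = 0" .
  then show "integral {0..2*pi} (\<lambda>x. support_function K (cos x *\<^sub>R u + sin x *\<^sub>R v) * cos (real k * x)) = 0"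
    by (simp add: p_def)
qed

lemma lacks_frequency_minus:
  assumes "lacks_frequency k f"
  shows "lacks_frequency k (\<lambda>x. f (- x))"
  unfolding lacks_frequency_def
proof (intro allI impI)
  fix u v :: 'a assume "norm u = 1 \<and> norm v = 1 \<and> u \<bullet> v = 0"
  then have "norm (- u) = 1 \<and> norm (- v) = 1 \<and> (- u) \<bullet> (- v) = 0" by simp
  with assms have "integral {0..2*pi} (\<lambda>x. f (cos x *\<^sub>R - u + sin x *\<^sub>R - v) * cos (real k * x)) = 0"
    unfolding lacks_frequency_def by blast
  then show "integral {0..2*pi} (\<lambda>x. f (- (cos x *\<^sub>R u + sin x *\<^sub>R v)) * cos (real k * x)) = 0"
    by simp
qed

lemma lacks_frequency_combination:
  fixes f g :: "'a::real_inner \<Rightarrow> real"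
  assumes "continuous_on UNIV f" "continuous_on UNIV g" "lacks_frequency k f" "lacks_frequency k g"
  shows "lacks_frequency k (\<lambda>x. c * f x + d * g x)"
  unfolding lacks_frequency_def
proof (intro allI impI)
  fix u v :: 'a assume uv: "norm u = 1 \<and> norm v = 1 \<and> u \<bullet> v = 0"
  have int: "(\<lambda>x. h (cos x *\<^sub>R u + sin x *\<^sub>R v) * cos (real k * x)) integrable_on {0..2*pi}"
    if "continuous_on UNIV h" for h :: "'a \<Rightarrow> real"
    by (intro integrable_continuous_interval continuous_intros continuous_on_compose2[OF that]) auto
  have zero: "((\<lambda>x. h (cos x *\<^sub>R u + sin x *\<^sub>R v) * cos (real k * x)) has_integral 0) {0..2*pi}"
    if "continuous_on UNIV h" "lacks_frequency k h" for h
    using integrable_integral[OF int[OF that(1)]] that(2) uv by (simp add: lacks_frequency_def)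
  have "((\<lambda>x. c * (f (cos x *\<^sub>R u + sin x *\<^sub>R v) * cos (real k * x)) + d * (g (cos x *\<^sub>R u + sin x *\<^sub>R v) * cos (real k * x)))
     has_integral c * 0 + d * 0) {0..2*pi}"
    by (intro has_integral_add has_integral_mult_right zero assms)
  then show "integral {0..2*pi} (\<lambda>x. (c * f (cos x *\<^sub>R u + sin x *\<^sub>R v) + d * g (cos x *\<^sub>R u + sin x *\<^sub>R v)) * cos (real k * x)) = 0"
    by (intro integral_unique) (simp add: algebra_simps)
qed

text \<open>The even part of the support function is constant on the unit sphere and the odd part is linear. A convex body is
  determined by its support function.\<close>

lemma euclidean_ball_if_projections_symmetric:
  fixes K :: "'a::euclidean_space set"
  assumes dim: "DIM('a) \<ge> 3" and K: "convex_body K"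
    and sym: "\<And>P. subspace P \<Longrightarrow> dim P = 2 \<Longrightarrow> \<exists>q\<ge>4. rotationally_symmetric q P (proj_onto K P)"
  shows "euclidean_ball K"
proof -
  note K' = convex_body_compact_nonempty[OF K]
  let ?h = "support_function K"
  have conth: "continuous_on UNIV ?h" by (rule continuous_on_support_function[OF K'(1,3)])
  then have conth': "continuous_on UNIV (\<lambda>x. ?h (- x))"
    by (intro continuous_on_compose2[OF conth] continuous_intros) auto
  \<comment> \<open>The order \<open>q \<ge> 4\<close> exceeds both frequencies 2 and 3.\<close>
  have sym4: "\<exists>q>k. rotationally_symmetric q P (proj_onto K P)" if P: "subspace P" "dim P = 2" "k \<le> 3" for P k
  proof -
    obtain q where "q \<ge> 4" "rotationally_symmetric q P (proj_onto K P)"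
      using sym[OF P(1,2)] by blast
    then show ?thesis using P(3) by (intro exI[of _ q]) simp
  qed
  have freq: "lacks_frequency 2 ?h" "lacks_frequency 3 ?h"
    using symmetric_projections_lack_frequency[OF K'(1,3), of 2] symmetric_projections_lack_frequency[OF K'(1,3), of 3] sym4
    by auto
  define f where "f x = (1/2) * ?h x + (1/2) * ?h (- x)" for x
  define g where "g x = (1/2) * ?h x + (-1/2) * ?h (- x)" for x
  have "lacks_frequency 2 f" "lacks_frequency 3 g"
    unfolding f_def g_def
    by (intro lacks_frequency_combination conth conth' freq lacks_frequency_minus)+
  moreover have "continuous_on UNIV f" "continuous_on UNIV g"
    unfolding f_def g_def by (intro continuous_intros conth conth')+
  moreover have "f (- x) = f x" for x by (simp add: f_def)
  moreover have "g (c *\<^sub>R x) = c * g x" for c x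
  proof (cases "c \<ge> 0")
    case True
    then show ?thesis
      using support_function_scaleR[OF K'(1,3) True, of x] support_function_scaleR[OF K'(1,3) True, of "- x"]
      by (simp add: g_def algebra_simps)
  next
    case False
    then have "- c \<ge> 0" by simp
    from support_function_scaleR[OF K'(1,3) this, of x] support_function_scaleR[OF K'(1,3) this, of "- x"]
    show ?thesis by (simp add: g_def algebra_simps)
  qed
  ultimately obtain c p where c: "\<And>x. norm x = 1 \<Longrightarrow> f x = c" and p: "\<And>x. g x = p \<bullet> x"
    using even_lacks_frequency_const[OF dim, of f] odd_lacks_frequency_linear[OF dim, of g] by blast
  have h: "?h x = c + p \<bullet> x" if "norm x = 1" for x
    using c[OF that] p[of x] by (simp add: f_def g_def)
  have "x \<in> K \<longleftrightarrow> x \<in> cball p c" for x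
  proof
    assume x: "x \<in> K"
    obtain u where u: "norm u = 1" "x - p = norm (x - p) *\<^sub>R u"
    proof (cases "x = p")
      case True
      then show ?thesis using that vector_choose_size[of 1] by auto
    next
      case False
      then show ?thesis using that[of "(x - p) /\<^sub>R norm (x - p)"] by simp
    qed
    have "norm (x - p) = (x - p) \<bullet> u"
      by (subst u(2)) (use u(1) in \<open>simp add: norm_eq_1\<close>)
    also have "\<dots> \<le> c"
      using inner_le_support_function[OF K'(1) x, of u] h[OF u(1)] by (simp add: inner_simps)
    finally show "x \<in> cball p c" by (simp add: dist_norm norm_minus_commute)
  next
    assume x: "x \<in> cball p c"
    show "x \<in> K"
      unfolding mem_iff_support_function[OF K']
    proof
      fix w
      show "x \<bullet> w \<le> ?h w"
      proof (cases "w = 0")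
        case True
        then show ?thesis using support_function_scaleR[OF K'(1,3), of 0 0] by simp
      next
        case False
        define u where "u = w /\<^sub>R norm w"
        have u: "norm u = 1" "w = norm w *\<^sub>R u" using False by (auto simp: u_def)
        have "(x - p) \<bullet> u \<le> norm (x - p) * norm u" by (rule norm_cauchy_schwarz)
        also have "\<dots> \<le> c" using x u(1) by (simp add: dist_norm norm_minus_commute)
        finally have "x \<bullet> u \<le> ?h u" using h[OF u(1)] by (simp add: inner_simps)
        then have "norm w * (x \<bullet> u) \<le> norm w * ?h u" by (intro mult_left_mono) auto
        also have "\<dots> = ?h (norm w *\<^sub>R u)" by (rule support_function_scaleR[OF K'(1,3), symmetric]) simp
        finally show ?thesis using u(2) by (metis inner_scaleR_right)
      qed
    qed
  qed
  then have "K = cball p c" by blast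
  moreover have "c > 0"
  proof (rule ccontr)
    assume "\<not> c > 0"
    then have "x = p" if "x \<in> cball p c" for x
      using that zero_le_dist[of p x] unfolding mem_cball by (metis dist_le_zero_iff dist_commute not_less order_trans)
    then have "cball p c \<subseteq> {p}" by blast
    then have "interior K \<subseteq> interior {p}" using \<open>K = cball p c\<close> interior_mono by blast
    then show False using K by (simp add: convex_body_def)
  qed
  ultimately show ?thesis unfolding euclidean_ball_def by blast
qed

section \<open>A body of constant width with threefold symmetric projections\<close>

text \<open>The perturbation of 1 is small enough for every one of these half-spaces to touch the body
  (\<open>support_function_cubic_body\<close>).\<close>

definition cubic_body :: "'a::euclidean_space \<Rightarrow> 'a set" where
  "cubic_body e = {x. \<forall>v. norm v = 1 \<longrightarrow> x \<bullet> v \<le> 1 + (v \<bullet> e) ^ 3 / 16}"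

text \<open>The gradient at the unit vector \<open>u\<close> of \<open>norm x + (x \<bullet> e) ^ 3 / (16 * norm x ^ 2)\<close>, the homogeneous extension
  of the support function, and thus the boundary point of \<open>cubic_body e\<close> with outer normal \<open>u\<close>.\<close>

definition cubic_support_point :: "'a::euclidean_space \<Rightarrow> 'a \<Rightarrow> 'a" where
  "cubic_support_point e u = u + (1/16) *\<^sub>R ((3 * (u \<bullet> e)\<^sup>2) *\<^sub>R e - (2 * (u \<bullet> e) ^ 3) *\<^sub>R u)"

lemma norm_diff_unit:
  fixes u v :: "'a::real_inner"
  assumes "norm u = 1" "norm v = 1"
  shows "(norm (u - v))\<^sup>2 = 2 * (1 - u \<bullet> v)"
proof -
  have "u \<bullet> u = 1" "v \<bullet> v = 1" using assms by (simp_all add: norm_eq_1)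
  then show ?thesis
    unfolding power2_norm_eq_inner by (simp add: inner_simps inner_commute)
qed

lemma cubic_support_point_self:
  assumes "norm u = 1"
  shows "cubic_support_point e u \<bullet> u = 1 + (u \<bullet> e) ^ 3 / 16"
proof -
  have "u \<bullet> u = 1" using assms by (simp add: norm_eq_1)
  then show ?thesis
    by (simp add: cubic_support_point_def inner_simps inner_commute power2_eq_square power3_eq_cube algebra_simps)
qed

text \<open>With \<open>a = u \<bullet> e\<close>, \<open>b = v \<bullet> e\<close>, \<open>c = u \<bullet> v\<close>, the gap between the two sides of the first inequality is
  \<open>(1 - c) + ((b - a)\<^sup>2 * (b + 2 * a) - 2 * a ^ 3 * (1 - c)) / 16\<close>. As \<open>(b - a)\<^sup>2 \<le> norm (u - v) ^ 2 = 2 * (1 - c)\<close>, the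
  cubic part is at most \<open>8 * (1 - c) / 16\<close> in absolute value, so the gap lies between \<open>(1 - c) / 2\<close> and
  \<open>3 * (1 - c) / 2\<close>. The first bound puts the support point into the body. The second makes the gap
  quadratically small as \<open>v\<close> tends to \<open>u\<close>, which yields the uniqueness of support points.\<close>

lemma cubic_support_point_bounds:
  assumes e: "norm e = 1" and u: "norm u = 1" and v: "norm v = 1"
  shows "cubic_support_point e u \<bullet> v \<le> 1 + (v \<bullet> e) ^ 3 / 16"
    and "1 + (v \<bullet> e) ^ 3 / 16 \<le> cubic_support_point e u \<bullet> v + 2 * (1 - u \<bullet> v)"
proof -
  define a b c where abc: "a = u \<bullet> e" "b = v \<bullet> e" "c = u \<bullet> v"
  define X Y where XY: "X = (b - a)\<^sup>2 * (b + 2 * a)" "Y = 2 * a ^ 3 * (1 - c)"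
  have a: "\<bar>a\<bar> \<le> 1" and b: "\<bar>b\<bar> \<le> 1" and c: "\<bar>c\<bar> \<le> 1"
    using Cauchy_Schwarz_ineq2[of u e] Cauchy_Schwarz_ineq2[of v e] Cauchy_Schwarz_ineq2[of u v] e u v
    by (simp_all add: abc)
  have "\<bar>(u - v) \<bullet> e\<bar> \<le> norm (u - v)"
    using Cauchy_Schwarz_ineq2[of "u - v" e] e by simp
  then have "((u - v) \<bullet> e)\<^sup>2 \<le> (norm (u - v))\<^sup>2"
    by (metis abs_le_square_iff abs_norm_cancel)
  then have ab: "(b - a)\<^sup>2 \<le> 2 * (1 - c)"
    unfolding norm_diff_unit[OF u v] by (simp add: abc inner_simps power2_commute)
  have "a ^ 3 \<le> 1" "- 1 \<le> a ^ 3"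
    using power_mono[of "\<bar>a\<bar>" 1 3] a by (auto simp flip: power_abs)
  then have a3: "\<bar>2 * a ^ 3 * (1 - c)\<bar> \<le> 2 * (1 - c)"
    unfolding abs_mult[of "2 * a ^ 3"] using c mult_right_mono[of "\<bar>2 * a ^ 3\<bar>" 2 "1 - c"] by simp
  have X: "\<bar>(b - a)\<^sup>2 * (b + 2 * a)\<bar> \<le> (2 * (1 - c)) * 3"
    unfolding abs_mult using a b c ab by (intro mult_mono) auto
  have gap: "1 + b ^ 3 / 16 - cubic_support_point e u \<bullet> v
     = (1 - c) + ((b - a)\<^sup>2 * (b + 2 * a) - 2 * a ^ 3 * (1 - c)) / 16"
    by (simp add: cubic_support_point_def inner_simps abc inner_commute power2_eq_square power3_eq_cube field_simps)
  show "cubic_support_point e u \<bullet> v \<le> 1 + (v \<bullet> e) ^ 3 / 16"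
    unfolding abc[symmetric] using gap X a3 c unfolding XY[symmetric] by argo
  show "1 + (v \<bullet> e) ^ 3 / 16 \<le> cubic_support_point e u \<bullet> v + 2 * (1 - u \<bullet> v)"
    unfolding abc[symmetric] using gap X a3 c unfolding XY[symmetric] by argo
qed

lemma cubic_support_point_in_body:
  assumes "norm e = 1" "norm u = 1"
  shows "cubic_support_point e u \<in> cubic_body e"
  using cubic_support_point_bounds(1)[OF assms] by (simp add: cubic_body_def)

text \<open>Two support points in direction \<open>v\<close> differ by a vector \<open>d\<close> orthogonal to \<open>v\<close>. By the second
  bound, \<open>d \<bullet> w\<close> is at most quadratic in the distance from \<open>w\<close> to \<open>v\<close>, whereas tilting \<open>v\<close> towards \<open>d\<close> makes it grow
  linearly unless \<open>d = 0\<close>.\<close>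

lemma cubic_body_support_point_unique:
  assumes e: "norm e = 1" and v: "norm v = 1" and x: "x \<in> cubic_body e"
    and eq: "x \<bullet> v = 1 + (v \<bullet> e) ^ 3 / 16"
  shows "x = cubic_support_point e v"
proof -
  define d where "d = x - cubic_support_point e v"
  have dv: "d \<bullet> v = 0"
    using eq cubic_support_point_self[OF v, of e] by (simp add: d_def inner_simps)
  have dw: "d \<bullet> w \<le> 2 * (1 - v \<bullet> w)" if w: "norm w = 1" for w
  proof -
    have "x \<bullet> w \<le> 1 + (w \<bullet> e) ^ 3 / 16" using x w by (simp add: cubic_body_def)
    also have "\<dots> \<le> cubic_support_point e v \<bullet> w + 2 * (1 - v \<bullet> w)"
      by (rule cubic_support_point_bounds(2)[OF e v w])
    finally show ?thesis by (simp add: d_def inner_simps)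
  qed
  have "d = 0"
  proof (rule ccontr)
    assume "d \<noteq> 0"
    define n where "n = d /\<^sub>R norm d"
    have n: "n \<bullet> n = 1" "n \<bullet> v = 0" "v \<bullet> n = 0" "d \<bullet> n = norm d"
      using \<open>d \<noteq> 0\<close> dv by (auto simp: n_def inner_commute power2_norm_eq_inner[symmetric] power2_eq_square)
    have vv: "v \<bullet> v = 1" using v by (simp add: norm_eq_1)
    have "norm d \<le> 2 * s" if s: "0 < s" for s :: real
    proof -
      define q where "q = 1 + s\<^sup>2"
      have q: "q > 0" by (auto simp: q_def intro: add_pos_nonneg)
      \<comment> \<open>The rational parametrisation of the circle through \<open>v\<close> and \<open>n\<close>, at distance of order \<open>s\<close> from \<open>v\<close>.\<close>
      define w where "w = ((1 - s\<^sup>2) / q) *\<^sub>R v + (2 * s / q) *\<^sub>R n"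
      have "w \<bullet> w = ((1 - s\<^sup>2) / q)\<^sup>2 + (2 * s / q)\<^sup>2"
        unfolding w_def power2_eq_square[of "_ / _"] by (simp add: inner_simps n vv)
      also have "\<dots> = ((1 - s\<^sup>2)\<^sup>2 + (2 * s)\<^sup>2) / q\<^sup>2"
        by (simp add: power_divide add_divide_distrib)
      also have "(1 - s\<^sup>2)\<^sup>2 + (2 * s)\<^sup>2 = q\<^sup>2"
        by (simp add: q_def power2_eq_square algebra_simps)
      finally have "norm w = 1" using q by (simp add: norm_eq_1)
      from dw[OF this] have "(2 * s * norm d) / q \<le> 2 * (1 - (1 - s\<^sup>2) / q)"
        by (simp add: w_def inner_simps n vv dv)
      also have "\<dots> = (4 * s\<^sup>2) / q"
        using q by (simp add: field_simps) (simp add: q_def)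
      finally have "2 * s * norm d \<le> 4 * s\<^sup>2"
        using q by (simp add: divide_le_cancel)
      then show ?thesis using s by (simp add: power2_eq_square)
    qed
    from this[of "norm d / 4"] show False using \<open>d \<noteq> 0\<close> by simp
  qed
  then show ?thesis by (simp add: d_def)
qed

lemma bounded_cubic_body:
  assumes e: "norm e = 1"
  shows "cubic_body e \<subseteq> cball 0 2"
proof
  fix x assume x: "x \<in> cubic_body e"
  show "x \<in> cball 0 2"
  proof (cases "x = 0")
    case False
    define v where "v = x /\<^sub>R norm x"
    have v: "norm v = 1" using False by (simp add: v_def)
    have "\<bar>v \<bullet> e\<bar> \<le> 1" using Cauchy_Schwarz_ineq2[of v e] v e by simp
    then have "(v \<bullet> e) ^ 3 \<le> 1" using power_mono[of "\<bar>v \<bullet> e\<bar>" 1 3] by (auto simp flip: power_abs)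
    moreover have "x \<bullet> v \<le> 1 + (v \<bullet> e) ^ 3 / 16" using x v by (simp add: cubic_body_def)
    moreover have "x \<bullet> v = norm x"
      using False by (simp add: v_def power2_norm_eq_inner[symmetric] power2_eq_square)
    ultimately show ?thesis by simp
  qed simp
qed

lemma cubic_body_eq_INT:
  "cubic_body e = (\<Inter>v\<in>sphere 0 1. {x. v \<bullet> x \<le> 1 + (v \<bullet> e) ^ 3 / 16})"
  by (auto simp: cubic_body_def inner_commute)

lemma compact_cubic_body:
  assumes "norm e = 1"
  shows "compact (cubic_body e)"
proof -
  have "closed (cubic_body e)"
    unfolding cubic_body_eq_INT by (intro closed_INT ballI closed_halfspace_le)
  then show ?thesis
    using bounded_cubic_body[OF assms] bounded_subset[OF bounded_cball] by (auto simp: compact_eq_bounded_closed)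
qed

lemma convex_cubic_body: "convex (cubic_body e)"
  unfolding cubic_body_eq_INT by (intro convex_INT convex_halfspace_le)

text \<open>By compactness of the sphere the strict inequalities hold with a uniform margin.\<close>

lemma interior_cubic_body:
  assumes e: "norm e = 1" and lt: "\<And>v. norm v = 1 \<Longrightarrow> z \<bullet> v < 1 + (v \<bullet> e) ^ 3 / 16"
  shows "z \<in> interior (cubic_body e)"
proof -
  let ?g = "\<lambda>v. 1 + (v \<bullet> e) ^ 3 / 16 - z \<bullet> v"
  have "e \<in> sphere 0 1" using e by simp
  then have ne: "sphere (0::'a) 1 \<noteq> {}" by blast
  have "continuous_on (sphere 0 1) ?g" by (intro continuous_intros) auto
  from continuous_attains_inf[OF compact_sphere ne this]
  obtain w where w: "norm w = 1" and min: "\<And>v. norm v = 1 \<Longrightarrow> ?g w \<le> ?g v"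
    by auto
  define r where "r = ?g w"
  have r: "r > 0" using lt[OF w] by (simp add: r_def)
  have "ball z r \<subseteq> cubic_body e"
    unfolding cubic_body_def
  proof (intro subsetI CollectI allI impI)
    fix x v :: 'a assume x: "x \<in> ball z r" and v: "norm v = 1"
    have "(x - z) \<bullet> v \<le> norm (x - z) * norm v" by (rule norm_cauchy_schwarz)
    also have "\<dots> \<le> r" using x v by (simp add: dist_norm norm_minus_commute)
    also have "r \<le> ?g v" unfolding r_def by (rule min[OF v])
    finally show "x \<bullet> v \<le> 1 + (v \<bullet> e) ^ 3 / 16" by (simp add: inner_simps)
  qed
  then show ?thesis using r by (meson interiorI open_ball centre_in_ball)
qed

text \<open>If an inner point of a segment lay on a supporting hyperplane, then both end points would, against the uniqueness of
  support points.\<close>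

lemma strictly_convex_cubic_body:
  assumes e: "norm e = 1"
  shows "strictly_convex_body (cubic_body e)"
proof -
  have "0 \<in> interior (cubic_body e)"
  proof (rule interior_cubic_body[OF e])
    fix v :: 'a assume v: "norm v = 1"
    have "\<bar>v \<bullet> e\<bar> \<le> 1" using Cauchy_Schwarz_ineq2[of v e] v e by simp
    then have "- 1 \<le> (v \<bullet> e) ^ 3" using power_mono[of "\<bar>v \<bullet> e\<bar>" 1 3] by (auto simp flip: power_abs)
    then show "0 \<bullet> v < 1 + (v \<bullet> e) ^ 3 / 16" by simp
  qed
  moreover have "open_segment x y \<subseteq> interior (cubic_body e)"
    if x: "x \<in> cubic_body e" and y: "y \<in> cubic_body e" and ne: "x \<noteq> y" for x y
  proof
    fix z assume "z \<in> open_segment x y"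
    then obtain t where t: "0 < t" "t < 1" and z: "z = (1 - t) *\<^sub>R x + t *\<^sub>R y"
      by (auto simp: in_segment)
    show "z \<in> interior (cubic_body e)"
    proof (rule interior_cubic_body[OF e])
      fix v :: 'a assume v: "norm v = 1"
      let ?h = "1 + (v \<bullet> e) ^ 3 / 16"
      have le: "x \<bullet> v \<le> ?h" "y \<bullet> v \<le> ?h" using x y v by (auto simp: cubic_body_def)
      have "\<not> (x \<bullet> v = ?h \<and> y \<bullet> v = ?h)"
        using cubic_body_support_point_unique[OF e v] x y ne by metis
      then have "x \<bullet> v < ?h \<or> y \<bullet> v < ?h" using le by linarith
      then have "(1 - t) * (x \<bullet> v) + t * (y \<bullet> v) < (1 - t) * ?h + t * ?h"
      proof
        assume "x \<bullet> v < ?h"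
        then show ?thesis using t le by (intro add_less_le_mono mult_strict_left_mono mult_left_mono) auto
      next
        assume "y \<bullet> v < ?h"
        then show ?thesis using t le by (intro add_le_less_mono mult_strict_left_mono mult_left_mono) auto
      qed
      also have "\<dots> = ?h" unfolding distrib_right[symmetric] by simp
      finally show "z \<bullet> v < ?h" by (simp add: z inner_simps)
    qed
  qed
  ultimately show ?thesis
    using compact_cubic_body[OF e] convex_cubic_body[of e]
    by (auto simp: strictly_convex_body_def convex_body_def)
qed

lemma support_function_cubic_body:
  assumes e: "norm e = 1" and u: "norm u = 1"
  shows "support_function (cubic_body e) u = 1 + (u \<bullet> e) ^ 3 / 16"
  unfolding support_function_def
proof (rule cSup_eq_maximum)
  show "1 + (u \<bullet> e) ^ 3 / 16 \<in> (\<lambda>x. x \<bullet> u) ` cubic_body e"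
    using cubic_support_point_in_body[OF e u] cubic_support_point_self[OF u, of e] by force
qed (use u in \<open>auto simp: cubic_body_def\<close>)

lemma constant_width_cubic_body:
  assumes e: "norm e = 1"
  shows "constant_width (cubic_body e)"
  unfolding constant_width_def
proof (intro exI allI impI)
  fix u :: 'a assume "norm u = 1"
  then show "support_function (cubic_body e) u + support_function (cubic_body e) (- u) = 2"
    using support_function_cubic_body[OF e, of u] support_function_cubic_body[OF e, of "- u"]
    by (simp add: power3_eq_cube)
qed

text \<open>A centre \<open>c\<close> would make the odd part \<open>(u \<bullet> e) ^ 3 / 16\<close> of the support function equal to \<open>c \<bullet> u\<close> on unit vectors,
  but it is not linear.\<close>

lemma not_centrally_symmetric_cubic_body:
  fixes e :: "'a::euclidean_space"
  assumes dim: "DIM('a) \<ge> 2" and e: "norm e = 1"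
  shows "\<not> centrally_symmetric (cubic_body e)"
proof
  let ?K = "cubic_body e"
  assume "centrally_symmetric ?K"
  then obtain c where c: "(\<lambda>x. 2 *\<^sub>R c - x) ` ?K = ?K" by (auto simp: centrally_symmetric_def)
  have le: "2 * (c \<bullet> u) \<le> (u \<bullet> e) ^ 3 / 8" if u: "norm u = 1" for u
  proof -
    have u': "norm (- u) = 1" using u by simp
    have "2 *\<^sub>R c - cubic_support_point e (- u) \<in> ?K"
      using c cubic_support_point_in_body[OF e u'] by blast
    then have "(2 *\<^sub>R c - cubic_support_point e (- u)) \<bullet> u \<le> 1 + (u \<bullet> e) ^ 3 / 16"
      using u by (simp add: cubic_body_def)
    moreover have "cubic_support_point e (- u) \<bullet> u = - (1 - (u \<bullet> e) ^ 3 / 16)"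
      using cubic_support_point_self[OF u', of e] by (simp add: power3_eq_cube)
    ultimately show ?thesis by (simp add: inner_simps)
  qed
  have eq: "2 * (c \<bullet> u) = (u \<bullet> e) ^ 3 / 8" if u: "norm u = 1" for u
    using le[OF u] le[of "- u"] u by (simp add: power3_eq_cube)
  obtain y where y: "y \<noteq> 0" "orthogonal e y" using orthogonal_to_vector_exists[OF dim] by metis
  define f where "f = y /\<^sub>R norm y"
  have f: "norm f = 1" "f \<bullet> e = 0" "e \<bullet> f = 0"
    using y by (auto simp: f_def orthogonal_def inner_commute)
  have ee: "e \<bullet> e = 1" "f \<bullet> f = 1" using e f by (simp_all add: norm_eq_1)
  \<comment> \<open>Linearity fails already for this rational point of the circle through \<open>e\<close> and \<open>f\<close>.\<close>
  have "norm ((3/5) *\<^sub>R e + (4/5) *\<^sub>R f) = 1"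
    by (simp add: norm_eq_1 inner_simps ee f)
  from eq[OF this] have "2 * (3/5 * (c \<bullet> e) + 4/5 * (c \<bullet> f)) = (3/5) ^ 3 / 8"
    by (simp add: inner_simps ee f)
  moreover have "2 * (c \<bullet> e) = 1 / 8" "2 * (c \<bullet> f) = 0"
    using eq[OF e] eq[OF f(1)] by (simp_all add: ee f)
  ultimately show False by (simp add: power3_eq_cube)
qed

text \<open>For \<open>X + \<i> * Z = r * cis \<tau>\<close> and \<open>s = sin (2 * \<pi> / 3)\<close>, the number \<open>s * Z - X / 2\<close> is the real part after a turn by
  \<open>- 2 * \<pi> / 3\<close>. The identity expresses that \<open>4 * X ^ 3 - 3 * r\<^sup>2 * X = r ^ 3 * cos (3 * \<tau>)\<close> is invariant
  under that turn.\<close>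

lemma cube_third_turn:
  fixes X Z s :: real
  assumes "s * s = 3/4"
  shows "X ^ 3 - (s * Z - X / 2) ^ 3 = 3/4 * (X * X + Z * Z) * (X - (s * Z - X / 2))"
proof -
  have "(s * Z - X / 2) ^ 3 = s * (s * s) * Z ^ 3 - (s * s) * (3/2 * X * Z\<^sup>2) + s * (3/4 * X\<^sup>2 * Z) - X ^ 3 / 8"
    by (simp add: power2_eq_square power3_eq_cube field_simps)
  then show ?thesis
    unfolding assms by (simp add: power2_eq_square power3_eq_cube field_simps)
qed

text \<open>Let \<open>turn s\<close> be the turn of \<open>P\<close> by \<open>2 * \<pi> / 3\<close> and \<open>pe\<close> the projection of \<open>e\<close> to \<open>P\<close>. By
  \<open>cube_third_turn\<close> the support values on \<open>P\<close> before and after the turn differ by the linear function \<open>b \<bullet> w\<close>, so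
  translating the turned projection by \<open>b\<close> gives the projection back.\<close>

lemma rotationally_symmetric_cubic_body:
  fixes e :: "'a::euclidean_space"
  assumes e: "norm e = 1" and P: "subspace P" "dim P = 2"
  shows "rotationally_symmetric 3 P (proj_onto (cubic_body e) P)"
proof -
  let ?K = "cubic_body e"
  let ?S = "proj_onto ?K P"
  have K: "compact ?K" "convex ?K" "?K \<noteq> {}"
    using compact_cubic_body[OF e] convex_cubic_body[of e] cubic_support_point_in_body[OF e e] by auto
  obtain B where B: "B \<subseteq> P" "pairwise orthogonal B" "\<And>x. x \<in> B \<Longrightarrow> norm x = 1" "card B = 2" "span B = P"
    using orthonormal_basis_subspace[OF P(1)] P(2) by metis
  then obtain u v where "B = {u, v}" "u \<noteq> v" by (auto simp: card_2_iff)
  then have uv: "norm u = 1" "norm v = 1" "u \<bullet> v = 0" and span: "span {u, v} = P"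
    using B by (auto simp: pairwise_def orthogonal_def)
  have inn: "u \<bullet> u = 1" "v \<bullet> v = 1" "u \<bullet> v = 0" "v \<bullet> u = 0"
    using uv by (auto simp: norm_eq_1 inner_commute)
  have inP: "\<alpha> *\<^sub>R u + \<beta> *\<^sub>R v \<in> P" for \<alpha> \<beta>
    unfolding span[symmetric] by (intro span_add span_scale span_base) auto
  have coord: "y = (y \<bullet> u) *\<^sub>R u + (y \<bullet> v) *\<^sub>R v" if "y \<in> P" for y
    by (rule plane_orthonormal_coordinates[OF uv]) (simp add: span that)
  define s where "s = sqrt 3 / 2"
  have ss: "s * s = 3/4" by (simp add: s_def)
  \<comment> \<open>As \<open>cos (2 * \<pi> / 3) = - 1/2\<close> and \<open>sin (2 * \<pi> / 3) = s\<close>, \<open>turn s\<close> is the turn by \<open>2 * \<pi> / 3\<close> and \<open>turn (- s)\<close> its inverse.\<close>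
  define turn where "turn s y = (- (y \<bullet> u) / 2 - s * (y \<bullet> v)) *\<^sub>R u + (s * (y \<bullet> u) - (y \<bullet> v) / 2) *\<^sub>R v"
    for s :: real and y
  have turn_coord: "turn t y \<bullet> u = - (y \<bullet> u) / 2 - t * (y \<bullet> v)" "turn t y \<bullet> v = t * (y \<bullet> u) - (y \<bullet> v) / 2" for t y
    by (simp_all add: turn_def inner_simps inn)
  have turnP: "turn t y \<in> P" for t y unfolding turn_def by (rule inP)
  have inner_coord: "y \<bullet> w = (y \<bullet> u) * (w \<bullet> u) + (y \<bullet> v) * (w \<bullet> v)" if "w \<in> P" for y w
    by (subst coord[OF that]) (simp add: inner_simps mult.commute)
  have turn_adj: "turn t y \<bullet> w = y \<bullet> turn (- t) w" if "w \<in> P" for t y w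
    unfolding inner_coord[OF that, of "turn t y"] inner_coord[OF turnP, of y] turn_coord by (simp add: algebra_simps)
  have turn_inv: "turn t (turn (- t) y) = y" if "t * t = 3/4" "y \<in> P" for t y
  proof -
    have "- ((- (y \<bullet> u) / 2 + t * (y \<bullet> v))) / 2 - t * (- t * (y \<bullet> u) - (y \<bullet> v) / 2) = (1/4 + t * t) * (y \<bullet> u)"
      "t * (- (y \<bullet> u) / 2 + t * (y \<bullet> v)) - (- t * (y \<bullet> u) - (y \<bullet> v) / 2) / 2 = (1/4 + t * t) * (y \<bullet> v)"
      by (simp_all add: field_simps)
    then have "turn t (turn (- t) y) = ((1/4 + t * t) * (y \<bullet> u)) *\<^sub>R u + ((1/4 + t * t) * (y \<bullet> v)) *\<^sub>R v"
      unfolding turn_def[of t] turn_coord by simp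
    then show ?thesis using that coord[OF that(2)] by simp
  qed
  have ss': "(- s) * (- s) = 3/4" using ss by simp
  have turn_norm: "norm (turn t y) = norm y" if "t * t = 3/4" "y \<in> P" for t y
    using turn_adj[OF turnP, of t y t y] turn_inv[of "- t" y] that by (simp add: norm_eq_sqrt_inner)
  define N where "N = (e \<bullet> u) * (e \<bullet> u) + (e \<bullet> v) * (e \<bullet> v)"
  define pe where "pe = (e \<bullet> u) *\<^sub>R u + (e \<bullet> v) *\<^sub>R v"
  \<comment> \<open>\<open>3/64\<close> is the coefficient \<open>1/16\<close> of the cubic form times the factor \<open>3/4\<close> of \<open>cube_third_turn\<close>.\<close>
  define b where "b = (3/64 * N) *\<^sub>R (pe - turn s pe)"
  have peP: "pe \<in> P" unfolding pe_def by (rule inP)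
  have bP: "b \<in> P"
    unfolding b_def using P(1) peP turnP by (intro subspace_scale subspace_diff)
  have pe: "pe \<bullet> w = w \<bullet> e" if "w \<in> P" for w
    using inner_coord[OF that, of pe] inner_coord[OF that, of e]
    by (simp add: pe_def inner_simps inn inner_commute)
  have key: "1 + (w \<bullet> e) ^ 3 / 16 = 1 + (turn (- s) w \<bullet> e) ^ 3 / 16 + b \<bullet> w"
    if w: "w \<in> P" "norm w = 1" for w
  proof -
    define X Z where XZ: "X = w \<bullet> e" "Z = (w \<bullet> v) * (e \<bullet> u) - (w \<bullet> u) * (e \<bullet> v)"
    have X: "X = (e \<bullet> u) * (w \<bullet> u) + (e \<bullet> v) * (w \<bullet> v)"
      using inner_coord[OF w(1), of e] by (simp add: XZ inner_commute)
    have X': "turn (- s) w \<bullet> e = s * Z - X / 2"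
      using inner_coord[OF turnP, of e "- s" w] unfolding X turn_coord
      by (simp add: XZ inner_commute algebra_simps add_divide_distrib)
    have "(w \<bullet> u) * (w \<bullet> u) + (w \<bullet> v) * (w \<bullet> v) = 1"
      using inner_coord[OF w(1), of w] w(2) by (simp add: norm_eq_1)
    moreover have "X * X + Z * Z = N * ((w \<bullet> u) * (w \<bullet> u) + (w \<bullet> v) * (w \<bullet> v))"
      unfolding X XZ(2) N_def by (simp add: algebra_simps)
    ultimately have "X * X + Z * Z = N" by simp
    moreover have "b \<bullet> w = 3/64 * N * (X - (s * Z - X / 2))"
      using turn_adj[OF w(1), of s pe] pe[OF w(1)] pe[OF turnP, of "- s" w] X'
      by (simp add: b_def inner_simps XZ(1))
    ultimately show ?thesis
      using cube_third_turn[OF ss, of X Z] X' by (simp add: XZ(1))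
  qed
  have memS: "y \<in> ?S \<longleftrightarrow> y \<in> P \<and> (\<forall>w\<in>P. norm w = 1 \<longrightarrow> y \<bullet> w \<le> 1 + (w \<bullet> e) ^ 3 / 16)" for y
  proof
    assume y: "y \<in> ?S"
    then have "y \<in> P" by (simp add: proj_onto_def)
    then show "y \<in> P \<and> (\<forall>w\<in>P. norm w = 1 \<longrightarrow> y \<bullet> w \<le> 1 + (w \<bullet> e) ^ 3 / 16)"
      using mem_proj_onto_iff[OF K P(1) \<open>y \<in> P\<close>] y support_function_cubic_body[OF e] by auto
  next
    assume y: "y \<in> P \<and> (\<forall>w\<in>P. norm w = 1 \<longrightarrow> y \<bullet> w \<le> 1 + (w \<bullet> e) ^ 3 / 16)"
    have "y \<bullet> w \<le> support_function ?K w" if "w \<in> P" for w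
    proof (cases "w = 0")
      case True
      then show ?thesis using support_function_scaleR[OF K(1,3), of 0 0] by simp
    next
      case False
      define n where "n = w /\<^sub>R norm w"
      have n: "norm n = 1" "w = norm w *\<^sub>R n" "n \<in> P"
        using False P(1) that by (auto simp: n_def subspace_scale)
      then have "y \<bullet> n \<le> support_function ?K n" using y support_function_cubic_body[OF e] by simp
      then have "norm w * (y \<bullet> n) \<le> norm w * support_function ?K n" by (intro mult_left_mono) auto
      also have "\<dots> = support_function ?K (norm w *\<^sub>R n)"
        by (rule support_function_scaleR[OF K(1,3), symmetric]) simp
      finally show ?thesis using n(2) by (metis inner_scaleR_right)
    qed
    then show "y \<in> ?S" using mem_proj_onto_iff[OF K P(1)] y by blast
  qed
  have "(\<lambda>y. turn s y + b) ` ?S = ?S"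
  proof
    show "(\<lambda>y. turn s y + b) ` ?S \<subseteq> ?S"
    proof
      fix z assume "z \<in> (\<lambda>y. turn s y + b) ` ?S"
      then obtain y where y: "y \<in> ?S" "z = turn s y + b" by blast
      have "z \<bullet> w \<le> 1 + (w \<bullet> e) ^ 3 / 16" if w: "w \<in> P" "norm w = 1" for w
      proof -
        have "z \<bullet> w = y \<bullet> turn (- s) w + b \<bullet> w"
          by (simp add: y(2) inner_add_left turn_adj[OF w(1)])
        also have "y \<bullet> turn (- s) w \<le> 1 + (turn (- s) w \<bullet> e) ^ 3 / 16"
          using y(1) turnP turn_norm[OF ss' w(1)] w(2) unfolding memS by simp
        finally show ?thesis using key[OF w] by linarith
      qed
      moreover have "z \<in> P" using y(2) turnP bP P(1) by (simp add: subspace_add)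
      ultimately show "z \<in> ?S" unfolding memS by blast
    qed
    show "?S \<subseteq> (\<lambda>y. turn s y + b) ` ?S"
    proof
      fix z assume z: "z \<in> ?S"
      then have zP: "z - b \<in> P" using bP P(1) by (auto simp: memS intro: subspace_diff)
      let ?y = "turn (- s) (z - b)"
      have "?y \<bullet> w \<le> 1 + (w \<bullet> e) ^ 3 / 16" if w: "w \<in> P" "norm w = 1" for w
      proof -
        have tn: "norm (turn s w) = 1" using turn_norm[OF ss w(1)] w(2) by simp
        have "?y \<bullet> w = z \<bullet> turn s w - b \<bullet> turn s w"
          using turn_adj[OF w(1), of "- s" "z - b"] by (simp add: inner_diff_left)
        also have "z \<bullet> turn s w \<le> 1 + (turn s w \<bullet> e) ^ 3 / 16"
          using z turnP turn_norm[OF ss w(1)] w(2) unfolding memS by simp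
        also have "1 + (turn s w \<bullet> e) ^ 3 / 16 - b \<bullet> turn s w = 1 + (turn (- s) (turn s w) \<bullet> e) ^ 3 / 16"
          using key[OF turnP tn] by linarith
        also have "turn (- s) (turn s w) = w" using turn_inv[OF ss' w(1)] by simp
        finally show ?thesis by simp
      qed
      then have "?y \<in> ?S" using turnP unfolding memS by blast
      moreover have "turn s ?y + b = z" using turn_inv[OF ss zP] by simp
      ultimately show "z \<in> (\<lambda>y. turn s y + b) ` ?S" by (metis imageI)
    qed
  qed
  moreover have "rotation_of_plane P (2 * pi / real 3) (turn s)"
    unfolding rotation_of_plane_def
  proof (intro exI conjI allI)
    show "orthogonal u v" using uv by (simp add: orthogonal_def)
    fix \<alpha> \<beta> :: real
    have "cos (2 * pi / 3) = - 1 / 2" "sin (2 * pi / 3) = s"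
      by (simp_all add: cos_120 sin_120 s_def)
    then show "turn s (\<alpha> *\<^sub>R u + \<beta> *\<^sub>R v) =
       (\<alpha> * cos (2 * pi / real 3) - \<beta> * sin (2 * pi / real 3)) *\<^sub>R u +
       (\<alpha> * sin (2 * pi / real 3) + \<beta> * cos (2 * pi / real 3)) *\<^sub>R v"
      by (simp add: turn_def inner_simps inn mult.commute)
  qed (use uv span in auto)
  ultimately show ?thesis
    using bP unfolding rotationally_symmetric_def by (metis of_nat_numeral)
qed

theorem theorem1p2:
  assumes "CARD('n::finite) \<ge> 3"
  shows "(\<forall>K :: (real ^ 'n) set.
            convex_body K \<and>
            (\<forall>P. subspace P \<and> dim P = 2 \<longrightarrow>
               (\<exists>q\<ge>4. rotationally_symmetric q P (proj_onto K P)))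
            \<longrightarrow> euclidean_ball K)
       \<and> (\<exists>K :: (real ^ 'n) set.
            strictly_convex_body K \<and> constant_width K \<and> \<not> centrally_symmetric K \<and>
            (\<forall>P. subspace P \<and> dim P = 2 \<longrightarrow>
               rotationally_symmetric 3 P (proj_onto K P)))"
proof -
  have dim: "DIM(real^'n) \<ge> 3" using assms by simp
  obtain e :: "real^'n" where e: "norm e = 1" using vector_choose_size[of 1] by auto
  have "strictly_convex_body (cubic_body e) \<and> constant_width (cubic_body e) \<and>
      \<not> centrally_symmetric (cubic_body e) \<and>
      (\<forall>P. subspace P \<and> dim P = 2 \<longrightarrow> rotationally_symmetric 3 P (proj_onto (cubic_body e) P))"
    using strictly_convex_cubic_body[OF e] constant_width_cubic_body[OF e]
      not_centrally_symmetric_cubic_body[OF _ e] rotationally_symmetric_cubic_body[OF e] dim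
    by auto
  then show ?thesis
    using euclidean_ball_if_projections_symmetric[OF dim] by blast
qed

end
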